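(* Let $p$ be a prime and suppose there exists $A\subseteq\mathbb{F}_p$ with $A-A\doteq\mathcal{R}_p$; write $p=2n(n-1)+1$ (with $n=|A|$). Then neither $n$ nor $n-1$ has a prime divisor congruent to $7$ modulo $8$. Moreover, of the two numbers $n$ and $n-1$, the odd one has no prime divisor congruent to $5$ modulo $8$, and the even one has no prime divisor congruent to $3$ modulo $8$.
   Context: $\mathcal{R}_p$ is the set of nonzero quadratic residues modulo $p$. $A-A\doteq S$ means: every element of $S$ has exactly one representation as $a'-a''$ with $a',a''\in A$, and every difference $a'-a''$ with $a'\ne a''$ in $A$ lies in $S$. *)

theory Defs
  imports "HOL-Number_Theory.Number_Theory"
begin

text \<open>Elements of F_p are represented by the integers 0..p-1.
  The set of nonzero quadratic residues modulo p.\<close>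
definition QR_set :: "int \<Rightarrow> int set" where
  "QR_set p = {x. 0 < x \<and> x < p \<and> QuadRes p x}"

definition diff_exact :: "int \<Rightarrow> int set \<Rightarrow> int set \<Rightarrow> bool" where
  "diff_exact p A S \<longleftrightarrow>
     (\<forall>s\<in>S. \<exists>!x. fst x \<in> A \<and> snd x \<in> A \<and> (fst x - snd x) mod p = s) \<and>
     (\<forall>a1\<in>A. \<forall>a2\<in>A. a1 \<noteq> a2 \<longrightarrow> (a1 - a2) mod p \<in> S)"

end

theory Submission
  imports Defs "HOL-Computational_Algebra.Polynomial"
begin

text \<open>The argument takes place in the group ring of \<open>Z/p\<close> over \<open>Z/q\<close>. Write \<open>n\<close> for the size of
  \<open>A\<close>, \<open>p = 4 M + 1\<close>, and \<open>R\<close>, \<open>N\<close> for the sums over residues and nonresidues, so that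
  \<open>A A\<^sup>- = n + R\<close>, where the exponent \<open>-\<close> negates the support, and \<open>2 M = n (n - 1)\<close>.

  Let \<open>q\<close> be a prime divisor of \<open>M\<close> and suppose that \<open>q^j\<close> is \<open>-1\<close> modulo \<open>p\<close>. By Frobenius,
  \<open>A^(q^j + 1) = n + R\<close> modulo \<open>q\<close>. Since \<open>R N = 0\<close> and \<open>R R = - R\<close> modulo \<open>q\<close>, this element is
  annihilated by \<open>N\<close> or \<open>R\<close>, hence so is \<open>A\<close> because the ring is reduced. For a nonresidue \<open>g\<close> it
  follows that the product of \<open>A\<close> with its dilate by \<open>g\<close> is constant modulo \<open>q\<close>; but its coefficients
  are \<open>0\<close> or \<open>1\<close>, a contradiction. So all prime divisors of \<open>M\<close> have odd order modulo \<open>p\<close>. As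
  \<open>n / (n - 1)\<close> is a square root of \<open>-1\<close>, this forces \<open>M\<close> to be odd, and then every odd prime
  divisor \<open>q\<close> of \<open>n (n - 1)\<close> is a quartic residue modulo \<open>p\<close>.

  Let \<open>D\<close> be the fourth powers minus their negatives. Then
  \<open>D D = - 2 M + c1 R + c2 N\<close> with \<open>c1 + c2 = 1\<close>, and the product of \<open>D\<close> with its dilate by \<open>g\<close> is
  \<open>w (R - N)\<close>, where \<open>p = (c1 - c2)^2 + (2 w)^2\<close>. Comparison with \<open>p = n^2 + (n - 1)^2\<close> identifies
  \<open>c1 - c2\<close> and \<open>2 w\<close> with the odd and the even one of \<open>n\<close>, \<open>n - 1\<close> up to sign. Finally
  \<open>D^q = D\<close> modulo \<open>q\<close>; computing \<open>D^q\<close> from \<open>D D\<close> shows that \<open>-2\<close> (if \<open>q\<close> divides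
  \<open>c1 - c2\<close>) respectively \<open>-1\<close> (if \<open>q\<close> divides \<open>w\<close>) is a square modulo \<open>q\<close>.\<close>

section \<open>The group ring of Z/p modulo q\<close>

locale group_ring =
  fixes p :: int
  assumes prime_p: "prime p"
begin

lemma p_gt_1: "p > 1"
  using prime_p by (simp add: prime_gt_1_int)

text \<open>Equality in the group ring of \<open>Z/p\<close> over \<open>Z/q\<close>, presented as integer polynomials modulo \<open>q\<close> and
  \<open>x^p - 1\<close>; for \<open>q = 0\<close> this is the integral group ring.\<close>
definition gcong :: "nat \<Rightarrow> int poly \<Rightarrow> int poly \<Rightarrow> bool" where
  "gcong q f g \<longleftrightarrow> (\<exists>u v. f - g = of_nat q * u + (monom 1 (nat p) - 1) * v)"

lemma gcongI: "f - g = of_nat q * u + (monom 1 (nat p) - 1) * v \<Longrightarrow> gcong q f g"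
  unfolding gcong_def by blast

lemma gcongE:
  assumes "gcong q f g"
  obtains u v where "f = g + of_nat q * u + (monom 1 (nat p) - 1) * v"
  using assms unfolding gcong_def by (metis add.assoc add_diff_cancel_left' diff_eq_eq add.commute)

lemma gcong_refl [simp, intro]: "gcong q f f"
  by (rule gcongI[of _ _ _ 0 0]) simp

lemma gcong_add: "gcong q f g \<Longrightarrow> gcong q f' g' \<Longrightarrow> gcong q (f + f') (g + g')"
proof (elim gcongE)
  fix u v u' v'
  assume "f = g + of_nat q * u + (monom 1 (nat p) - 1) * v"
    "f' = g' + of_nat q * u' + (monom 1 (nat p) - 1) * v'"
  then show ?thesis
    by (intro gcongI[of _ _ _ "u + u'" "v + v'"]) (simp add: algebra_simps)
qed

lemma gcong_mult: "gcong q f g \<Longrightarrow> gcong q f' g' \<Longrightarrow> gcong q (f * f') (g * g')"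
proof (elim gcongE)
  fix u v u' v'
  define x where "x = monom 1 (nat p) - (1 :: int poly)"
  assume "f = g + of_nat q * u + (monom 1 (nat p) - 1) * v"
    "f' = g' + of_nat q * u' + (monom 1 (nat p) - 1) * v'"
  then have "f = g + of_nat q * u + x * v" "f' = g' + of_nat q * u' + x * v'"
    by (simp_all add: x_def)
  then show ?thesis
    by (intro gcongI[of _ _ _ "u * f' + u' * g" "v * f' + v' * g"], fold x_def)
       (simp add: algebra_simps)
qed

lemma gcong_minus: "gcong q f g \<Longrightarrow> gcong q (- f) (- g)"
  using gcong_mult[of q "-1" "-1" f g] by simp

lemma gcong_diff: "gcong q f g \<Longrightarrow> gcong q f' g' \<Longrightarrow> gcong q (f - f') (g - g')"
  using gcong_add[OF _ gcong_minus] by fastforce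

lemma gcong_sym: "gcong q f g \<Longrightarrow> gcong q g f"
  using gcong_minus[of q "f" g] gcong_add[of q "-f" "-g" "f+g" "f+g"] by simp

lemma gcong_trans [trans]: "gcong q f g \<Longrightarrow> gcong q g h \<Longrightarrow> gcong q f h"
  using gcong_add[of q f g g h] gcong_diff[of q "f + g" "g + h" g g] by simp

lemma gcong_power: "gcong q f g \<Longrightarrow> gcong q (f ^ k) (g ^ k)"
  by (induction k) (auto intro: gcong_mult)

lemma gcong_sum: "(\<And>x. x \<in> S \<Longrightarrow> gcong q (f x) (g x)) \<Longrightarrow> gcong q (sum f S) (sum g S)"
  by (induction S rule: infinite_finite_induct) (auto intro: gcong_add)

lemma gcong_smult: "gcong q f g \<Longrightarrow> gcong q (smult c f) (smult c g)"
  using gcong_mult[of q "[:c:]" "[:c:]" f g] by simp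

lemma gcong_smult_left: "[c = d] (mod int q) \<Longrightarrow> gcong q (smult c f) (smult d f)"
proof -
  assume "[c = d] (mod int q)"
  then obtain k where k: "c = d + int q * k"
    by (metis cong_iff_lin cong_sym)
  show ?thesis
    by (rule gcongI[of _ _ _ "smult k f" 0])
       (simp add: k smult_add_left of_nat_poly mult.commute)
qed

text \<open>Reducing the exponent first makes \<open>X\<close> depend only on the class of
  \<open>i\<close>, as an equality of polynomials; the relation x^p = 1 enters through
  \<open>X_mult\<close>.\<close>

definition X :: "int \<Rightarrow> int poly" where
  "X i = monom 1 (nat (i mod p))"

lemma X_cong: "[i = j] (mod p) \<Longrightarrow> X i = X j"
  by (simp add: X_def cong_def)

lemma X_0 [simp]: "X 0 = 1"
  by (simp add: X_def)

lemma X_mult: "gcong q (X i * X j) (X (i + j))"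
proof -
  define a b where "a = i mod p" and "b = j mod p"
  have ab: "0 \<le> a" "a < p" "0 \<le> b" "b < p"
    using p_gt_1 by (auto simp: a_def b_def)
  have 1: "X i * X j = monom 1 (nat (a + b))"
    using ab by (simp add: X_def a_def[symmetric] b_def[symmetric] mult_monom nat_add_distrib)
  have 2: "(i + j) mod p = (a + b) mod p"
    by (simp add: a_def b_def mod_add_eq)
  show ?thesis
  proof (cases "a + b < p")
    case True
    then show ?thesis using 1 2 ab by (simp add: X_def)
  next
    case False
    then have 3: "(a + b) mod p = a + b - p"
      using ab by (intro int_mod_pos_eq[of _ _ 1]) auto
    have "nat (a + b) = nat p + nat (a + b - p)"
      using ab False by simp
    then have "X i * X j = monom 1 (nat p) * X (i + j)"
      unfolding 1 by (simp only: X_def 2 3 mult_monom mult_1)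
    then show ?thesis
      by (intro gcongI[of _ _ _ 0 "X (i + j)"]) (simp add: algebra_simps)
  qed
qed

lemma X_power: "gcong q (X i ^ k) (X (int k * i))"
proof (induction k)
  case (Suc k)
  have "gcong q (X i ^ Suc k) (X i * X (int k * i))"
    using gcong_mult[OF gcong_refl Suc.IH] by simp
  also have "gcong q \<dots> (X (i + int k * i))" by (rule X_mult)
  finally show ?case by (simp add: algebra_simps)
qed auto

section \<open>Periodic functions as elements of the group ring\<close>

definition emb :: "(int \<Rightarrow> int) \<Rightarrow> int poly" where
  "emb \<phi> = (\<Sum>x\<in>{0..<p}. smult (\<phi> x) (X x))"

definition conv :: "(int \<Rightarrow> int) \<Rightarrow> (int \<Rightarrow> int) \<Rightarrow> int \<Rightarrow> int" where
  "conv \<phi> \<psi> z = (\<Sum>y\<in>{0..<p}. \<phi> y * \<psi> (z - y))"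

text \<open>Functions are kept on all integers instead of on \<open>{0..<p}\<close>, so that
  dilation, translation and reflection are plain substitutions; periodicity is what makes them
  functions on Z/p.\<close>

definition periodic :: "(int \<Rightarrow> 'a) \<Rightarrow> bool" where
  "periodic \<phi> \<longleftrightarrow> (\<forall>x. \<phi> (x mod p) = \<phi> x)"

lemma periodicD: "periodic \<phi> \<Longrightarrow> [x = y] (mod p) \<Longrightarrow> \<phi> x = \<phi> y"
  unfolding periodic_def cong_def by metis

lemma periodicI: "(\<And>x y. [x = y] (mod p) \<Longrightarrow> \<phi> x = \<phi> y) \<Longrightarrow> periodic \<phi>"
  unfolding periodic_def by (meson cong_mod_left cong_refl)

lemma periodic_affine: "periodic \<phi> \<Longrightarrow> periodic (\<lambda>x. \<phi> (t * x + c))"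
  by (rule periodicI) (auto intro!: periodicD[of \<phi>] cong_add cong_mult)

lemma periodic_scale [intro]: "periodic \<phi> \<Longrightarrow> periodic (\<lambda>x. \<phi> (t * x))"
  using periodic_affine[of \<phi> t 0] by simp

lemma periodic_conv [intro]: "periodic \<psi> \<Longrightarrow> periodic (conv \<phi> \<psi>)"
  unfolding conv_def
  by (rule periodicI, rule sum.cong) (auto intro!: periodicD[of \<psi>] cong_diff)

text \<open>An affine map with unit slope permutes Z/p. All later changes of variable (scaling,
  shifting, reflecting) are instances.\<close>

lemma sum_affine:
  fixes f :: "int \<Rightarrow> 'a :: comm_monoid_add"
  assumes "periodic f" "coprime t p"
  shows "(\<Sum>x\<in>{0..<p}. f (t * x + c)) = (\<Sum>x\<in>{0..<p}. f x)"
proof -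
  have inj: "inj_on (\<lambda>x. (t * x + c) mod p) {0..<p}"
  proof (rule inj_onI)
    fix x y assume xy: "x \<in> {0..<p}" "y \<in> {0..<p}" "(t * x + c) mod p = (t * y + c) mod p"
    then have "[t * x + c = t * y + c] (mod p)" by (simp add: cong_def)
    then have "[t * x = t * y] (mod p)" by (simp add: cong_add_rcancel)
    then have "[x = y] (mod p)" using assms(2) by (simp add: cong_mult_lcancel)
    then show "x = y" using xy by (simp add: cong_def)
  qed
  have "(\<lambda>x. (t * x + c) mod p) ` {0..<p} = {0..<p}"
    by (rule card_subset_eq) (use p_gt_1 in \<open>auto simp: card_image[OF inj]\<close>)
  then have bij: "bij_betw (\<lambda>x. (t * x + c) mod p) {0..<p} {0..<p}"
    using inj by (simp add: bij_betw_def)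
  have "(\<Sum>x\<in>{0..<p}. f (t * x + c)) = (\<Sum>x\<in>{0..<p}. f ((t * x + c) mod p))"
    using assms(1) by (simp add: periodic_def)
  also have "\<dots> = (\<Sum>x\<in>{0..<p}. f x)"
    by (rule sum.reindex_bij_betw[OF bij])
  finally show ?thesis .
qed

lemma sum_scale:
  fixes f :: "int \<Rightarrow> 'a :: comm_monoid_add"
  assumes "periodic f" "coprime t p"
  shows "(\<Sum>x\<in>{0..<p}. f (t * x)) = (\<Sum>x\<in>{0..<p}. f x)"
  using sum_affine[OF assms, of 0] by simp

lemma sum_shift:
  fixes f :: "int \<Rightarrow> 'a :: comm_monoid_add"
  assumes "periodic f"
  shows "(\<Sum>x\<in>{0..<p}. f (x - c)) = (\<Sum>x\<in>{0..<p}. f x)"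
  using sum_affine[OF assms, of 1 "-c"] by simp

lemma sum_conv:
  assumes "periodic \<psi>"
  shows "(\<Sum>z\<in>{0..<p}. conv \<phi> \<psi> z) = (\<Sum>x\<in>{0..<p}. \<phi> x) * (\<Sum>x\<in>{0..<p}. \<psi> x)"
  unfolding conv_def
  by (subst sum.swap, subst sum_distrib_left[symmetric], subst sum_shift[OF assms])
     (simp add: sum_distrib_right)

text \<open>Dilation by a unit is an automorphism of the group ring; concretely, substitute
  \<open>t * y\<close> for the summation variable.\<close>

lemma conv_scale:
  assumes "periodic \<phi>" "periodic \<psi>" "coprime t p"
  shows "conv \<phi> \<psi> (t * z) = conv (\<lambda>x. \<phi> (t * x)) (\<lambda>x. \<psi> (t * x)) z"
proof -
  have per: "periodic (\<lambda>y. \<phi> y * \<psi> (t * z - y))"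
    by (rule periodicI)
       (auto intro!: arg_cong2[of _ _ _ _ "(*)"] periodicD[OF assms(1)] periodicD[OF assms(2)] cong_diff)
  show ?thesis
    unfolding conv_def sum_scale[OF per assms(3), symmetric]
    by (simp add: algebra_simps)
qed

lemma emb_add: "emb (\<lambda>x. \<phi> x + \<psi> x) = emb \<phi> + emb \<psi>"
  by (simp add: emb_def smult_add_left sum.distrib)

lemma emb_diff: "emb (\<lambda>x. \<phi> x - \<psi> x) = emb \<phi> - emb \<psi>"
  by (simp add: emb_def smult_diff_left sum_subtractf)

lemma emb_mult_const: "emb (\<lambda>x. c * \<phi> x) = smult c (emb \<phi>)"
  by (rule poly_eqI) (simp add: emb_def coeff_sum sum_distrib_left mult.assoc)

lemma emb_mult:
  assumes "periodic \<psi>"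
  shows "gcong q (emb \<phi> * emb \<psi>) (emb (conv \<phi> \<psi>))"
proof -
  have shift: "(\<Sum>x\<in>{0..<p}. smult (\<phi> y * \<psi> x) (X (y + x)))
      = (\<Sum>x\<in>{0..<p}. smult (\<phi> y * \<psi> (x - y)) (X x))" for y
  proof -
    have "periodic (\<lambda>x. smult (\<phi> y * \<psi> x) (X (y + x)))"
    proof (rule periodicI)
      fix a b assume ab: "[a = b] (mod p)"
      have "X (y + a) = X (y + b)"
        using cong_add[OF cong_refl ab, of y] by (simp add: X_def cong_def)
      then show "smult (\<phi> y * \<psi> a) (X (y + a)) = smult (\<phi> y * \<psi> b) (X (y + b))"
        using periodicD[OF assms ab] by simp
    qed
    from sum_shift[OF this, of y, symmetric] show ?thesis by simp
  qed
  have "emb \<phi> * emb \<psi> = (\<Sum>y\<in>{0..<p}. \<Sum>x\<in>{0..<p}. smult (\<phi> y * \<psi> x) (X y * X x))"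
    by (simp add: emb_def sum_product mult.commute)
  also have "gcong q \<dots> (\<Sum>y\<in>{0..<p}. \<Sum>x\<in>{0..<p}. smult (\<phi> y * \<psi> x) (X (y + x)))"
    by (intro gcong_sum gcong_smult X_mult)
  also have "(\<Sum>y\<in>{0..<p}. \<Sum>x\<in>{0..<p}. smult (\<phi> y * \<psi> x) (X (y + x)))
      = (\<Sum>x\<in>{0..<p}. \<Sum>y\<in>{0..<p}. smult (\<phi> y * \<psi> (x - y)) (X x))"
    unfolding shift by (rule sum.swap)
  also have "\<dots> = emb (conv \<phi> \<psi>)"
    by (simp add: emb_def conv_def smult_sum)
  finally show ?thesis .
qed

lemma gcong_emb: "(\<And>x. [\<phi> x = \<psi> x] (mod int q)) \<Longrightarrow> gcong q (emb \<phi>) (emb \<psi>)"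
  unfolding emb_def by (intro gcong_sum gcong_smult_left) auto

text \<open>The coefficient at \<open>j\<close> in the group ring: modulo x^p - 1, coefficients at
  exponents congruent modulo \<open>p\<close> add up. The sum is truncated at \<open>K\<close>; for
  \<open>emb\<close> any positive \<open>K\<close> will do, whereas multiples of x^p - 1 need a
  large one.\<close>

definition fold_coeff :: "nat \<Rightarrow> int \<Rightarrow> int poly \<Rightarrow> int" where
  "fold_coeff K j f = (\<Sum>i<K. coeff f (nat j + nat p * i))"

lemma fold_coeff_emb:
  assumes "x \<in> {0..<p}" "K > 0"
  shows "fold_coeff K x (emb \<phi>) = \<phi> x"
proof -
  have "coeff (emb \<phi>) (nat x + nat p * i) = (if i = 0 then \<phi> x else 0)" for i
  proof -
    have "coeff (emb \<phi>) (nat x + nat p * i)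
        = (\<Sum>y\<in>{0..<p}. if y = x + p * int i then \<phi> y else 0)"
      unfolding emb_def coeff_sum
    proof (rule sum.cong)
      fix y assume "y \<in> {0..<p}"
      moreover have "nat x + nat p * i = nat (x + p * int i)"
        using assms p_gt_1 by (simp add: nat_add_distrib nat_mult_distrib)
      moreover have "x + p * int i \<ge> 0" using assms p_gt_1 by simp
      ultimately show "coeff (smult (\<phi> y) (X y)) (nat x + nat p * i) = (if y = x + p * int i then \<phi> y else 0)"
        by (simp add: X_def nat_eq_iff)
    qed simp
    also have "\<dots> = (if x + p * int i \<in> {0..<p} then \<phi> (x + p * int i) else 0)"
      by (simp add: sum.delta)
    also have "x + p * int i \<in> {0..<p} \<longleftrightarrow> i = 0"
    proof
      assume "x + p * int i \<in> {0..<p}"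
      then have "p * int i < p * 1"
        unfolding mult_1_right atLeastLessThan_iff using assms(1) unfolding atLeastLessThan_iff by linarith
      then have "int i < 1" using p_gt_1 mult_less_cancel_left_pos[of p "int i" 1] by linarith
      then show "i = 0" by simp
    qed (use assms in auto)
    finally show ?thesis by auto
  qed
  then show ?thesis using assms(2) by (simp add: fold_coeff_def)
qed

text \<open>Multiplication by x^p - 1 makes the sum telescope. The one term left over sits at an
  exponent above the degree of \<open>v\<close>, by the bound on \<open>K\<close>.\<close>

lemma fold_coeff_relation:
  assumes "x \<in> {0..<p}" "K > degree v + 1"
  shows "fold_coeff K x ((monom 1 (nat p) - 1) * v) = 0"
proof -
  have K: "K > 0" and p: "nat p > 0" using assms(2) p_gt_1 by auto
  have *: "coeff ((monom 1 (nat p) - 1) * v) (nat x + nat p * i)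
      = (if i = 0 then 0 else coeff v (nat x + nat p * (i - 1))) - coeff v (nat x + nat p * i)" for i
  proof (cases i)
    case 0
    have "nat x < nat p" using assms(1) by auto
    then show ?thesis using 0 by (simp add: left_diff_distrib coeff_monom_mult)
  next
    case (Suc k)
    then show ?thesis by (simp add: left_diff_distrib coeff_monom_mult)
  qed
  have "fold_coeff K x ((monom 1 (nat p) - 1) * v) = - coeff v (nat x + nat p * (K - 1))"
    unfolding fold_coeff_def * using K
  proof (induction K)
    case (Suc k)
    then show ?case by (cases k) auto
  qed auto
  also have "nat x + nat p * (K - 1) > degree v"
    using assms(2) p mult_le_mono1[of 1 "nat p" "K - 1"] by linarith
  then have "coeff v (nat x + nat p * (K - 1)) = 0"
    by (rule coeff_eq_0)
  finally show ?thesis by simp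
qed

lemma dvd_of_gcong_emb_0:
  assumes "gcong q (emb \<phi>) 0" "x \<in> {0..<p}"
  shows "int q dvd \<phi> x"
proof -
  from assms(1) obtain u v where uv: "emb \<phi> = of_nat q * u + (monom 1 (nat p) - 1) * v"
    using gcongE[OF assms(1)] by (metis add_0)
  define K where "K = degree v + 2"
  have "\<phi> x = fold_coeff K x (emb \<phi>)"
    using fold_coeff_emb[OF assms(2), of K] by (simp add: K_def)
  also have "\<dots> = fold_coeff K x (of_nat q * u + (monom 1 (nat p) - 1) * v)"
    by (simp only: uv)
  also have "\<dots> = fold_coeff K x (of_nat q * u) + fold_coeff K x ((monom 1 (nat p) - 1) * v)"
    by (simp add: fold_coeff_def sum.distrib)
  also have "\<dots> = int q * fold_coeff K x u"
  proof -
    have "fold_coeff K x ((monom 1 (nat p) - 1) * v) = 0"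
      by (rule fold_coeff_relation[OF assms(2)]) (simp add: K_def)
    then show ?thesis
      by (simp add: of_nat_poly) (simp add: fold_coeff_def sum_distrib_left)
  qed
  finally show ?thesis by simp
qed

text \<open>The way back from the group ring to coefficients. For \<open>q = 0\<close> the
  conclusion is an equality of integers, which is how \<open>p_two_squares\<close> obtains an exact
  identity.\<close>

lemma gcong_embD:
  assumes "gcong q (emb \<phi>) (emb \<psi>)" "periodic \<phi>" "periodic \<psi>"
  shows "[\<phi> x = \<psi> x] (mod int q)"
proof -
  have "gcong q (emb (\<lambda>x. \<phi> x - \<psi> x)) 0"
    using gcong_diff[OF assms(1) gcong_refl[of q "emb \<psi>"]] by (simp add: emb_diff)
  from dvd_of_gcong_emb_0[OF this, of "x mod p"]
  have "int q dvd \<phi> (x mod p) - \<psi> (x mod p)" using p_gt_1 by simp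
  then show ?thesis using assms(2,3) by (simp add: periodic_def cong_iff_dvd_diff)
qed

end

section \<open>The Frobenius map and reducedness modulo q\<close>

lemma fermat_theorem_int:
  fixes c :: int
  assumes q: "prime q" and c: "\<not> int q dvd c"
  shows "[c ^ (q - 1) = 1] (mod int q)"
proof -
  define m where "m = nat (c mod int q)"
  have m: "int m = c mod int q"
    using prime_gt_0_nat[OF q] by (simp add: m_def)
  have "\<not> q dvd m"
    using c m by (metis int_dvd_int_iff dvd_mod_iff dvd_refl)
  then have "[int (m ^ (q - 1)) = int 1] (mod int q)"
    using fermat_theorem[OF q] by (simp only: cong_int_iff)
  moreover have "[c ^ (q - 1) = int m ^ (q - 1)] (mod int q)"
    by (rule cong_pow) (simp add: m cong_def)
  ultimately show ?thesis
    using cong_trans by fastforce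
qed

lemma fermat_cong_int:
  fixes c :: int
  assumes q: "prime q"
  shows "[c ^ q = c] (mod int q)"
proof -
  have pow: "c ^ q = c * c ^ (q - 1)"
    using prime_gt_0_nat[OF q] by (cases q) auto
  show ?thesis
  proof (cases "int q dvd c")
    case True
    then show ?thesis unfolding pow by (simp add: cong_iff_dvd_diff)
  next
    case False
    show ?thesis
      unfolding pow using cong_scalar_left[OF fermat_theorem_int[OF q False], of c] by simp
  qed
qed

context group_ring
begin

lemma freshman:
  assumes q: "prime q"
  shows "gcong q ((f + g) ^ q) (f ^ q + g ^ q)"
proof -
  have "(f + g) ^ q = (\<Sum>k\<le>q. of_nat (q choose k) * f ^ k * g ^ (q - k))"
    by (rule binomial_ring)
  also have "gcong q \<dots> (\<Sum>k\<le>q. if k \<in> {0, q} then f ^ k * g ^ (q - k) else 0)"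
  proof (rule gcong_sum)
    fix k assume k: "k \<in> {..q}"
    show "gcong q (of_nat (q choose k) * f ^ k * g ^ (q - k))
        (if k \<in> {0, q} then f ^ k * g ^ (q - k) else 0)"
    proof (cases "k \<in> {0, q}")
      case False
      then have "q dvd (q choose k)"
        using k q by (intro dvd_choose_prime) auto
      then obtain m where "q choose k = q * m" ..
      then show ?thesis using False
        by (intro gcongI[of _ _ _ "of_nat m * f ^ k * g ^ (q - k)" 0]) simp
    qed auto
  qed
  also have "(\<Sum>k\<le>q. if k \<in> {0, q} then f ^ k * g ^ (q - k) else 0)
      = (\<Sum>k\<in>{0, q}. f ^ k * g ^ (q - k))"
    by (subst sum.inter_restrict[symmetric]) (auto intro!: sum.cong)
  also have "\<dots> = f ^ q + g ^ q"
    using prime_gt_0_nat[OF q] by simp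
  finally show ?thesis .
qed

lemma frobenius_sum:
  assumes q: "prime q" and "finite S"
  shows "gcong q ((\<Sum>x\<in>S. smult (c x) (X (e x))) ^ q) (\<Sum>x\<in>S. smult (c x) (X (int q * e x)))"
  using assms(2)
proof induction
  case empty
  have "(0 :: int poly) ^ q = 0" using prime_gt_0_nat[OF q] by (rule zero_power)
  then show ?case by (simp only: sum.empty gcong_refl)
next
  case (insert x S)
  let ?t = "smult (c x) (X (e x))"
  have "gcong q (?t ^ q) (smult (c x ^ q) (X (int q * e x)))"
    unfolding smult_power by (rule gcong_smult[OF X_power])
  also have "gcong q \<dots> (smult (c x) (X (int q * e x)))"
    by (rule gcong_smult_left[OF fermat_cong_int[OF q]])
  finally have t: "gcong q (?t ^ q) (smult (c x) (X (int q * e x)))" .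
  have "gcong q ((?t + (\<Sum>x\<in>S. smult (c x) (X (e x)))) ^ q)
      (?t ^ q + (\<Sum>x\<in>S. smult (c x) (X (e x))) ^ q)"
    by (rule freshman[OF q])
  also have "gcong q \<dots>
      (smult (c x) (X (int q * e x)) + (\<Sum>x\<in>S. smult (c x) (X (int q * e x))))"
    by (rule gcong_add[OF t insert.IH])
  finally show ?case using insert.hyps by simp
qed

text \<open>The \<open>q\<close>-th power multiplies every exponent by \<open>q\<close> and, by
  Fermat, keeps the coefficients. Writing the dilate on the left avoids an inverse of
  \<open>q\<close> modulo \<open>p\<close>.\<close>

lemma frobenius:
  assumes q: "prime q" "coprime (int q) p" and \<psi>: "periodic \<psi>"
  shows "gcong q (emb (\<lambda>x. \<psi> (int q * x)) ^ q) (emb \<psi>)"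
proof -
  have "periodic (\<lambda>x. smult (\<psi> x) (X x))"
    by (rule periodicI, rule arg_cong2[where f = smult])
       (auto intro: periodicD[OF \<psi>] X_cong)
  from sum_scale[OF this q(2)] frobenius_sum[OF q(1), of "{0..<p}" "\<lambda>x. \<psi> (int q * x)" "\<lambda>x. x"]
  show ?thesis by (simp add: emb_def)
qed

lemma frobenius_iterate:
  assumes q: "prime q" "coprime (int q) p" and \<psi>: "periodic \<psi>"
  shows "gcong q (emb (\<lambda>x. \<psi> (int q ^ j * x)) ^ (q ^ j)) (emb \<psi>)"
  using \<psi>
proof (induction j arbitrary: \<psi>)
  case (Suc j)
  have "emb (\<lambda>x. \<psi> (int q ^ Suc j * x)) ^ (q ^ Suc j)
      = (emb (\<lambda>x. \<psi> (int q ^ j * (int q * x))) ^ q) ^ (q ^ j)"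
    by (simp add: power_mult[symmetric] mult.assoc mult.left_commute)
  also have "gcong q \<dots> (emb (\<lambda>x. \<psi> (int q ^ j * x)) ^ (q ^ j))"
    using Suc.prems by (intro gcong_power frobenius[OF q, of "\<lambda>x. \<psi> (int q ^ j * x)"]) auto
  also have "gcong q \<dots> (emb \<psi>)"
    by (rule Suc.IH[OF Suc.prems])
  finally show ?case .
qed auto

text \<open>Since \<open>q\<close> is a unit modulo \<open>p\<close>, some Frobenius power fixes every element;
  so the group ring modulo \<open>q\<close> is reduced.\<close>
lemma gcong_0_of_power:
  assumes q: "prime q" "coprime (int q) p" and \<phi>: "periodic \<phi>"
    and 0: "gcong q (emb \<phi> ^ k) 0"
  shows "gcong q (emb \<phi>) 0"
proof -
  \<comment> \<open>The factor p - 1 gives q^t = 1 modulo \<open>p\<close>, so this Frobenius power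
    fixes \<open>emb \<phi>\<close>; the factor \<open>k\<close> makes q^t exceed
    \<open>k\<close>.\<close>
  define t where "t = (nat p - 1) * k"
  have "\<not> p dvd int q"
  proof
    assume "p dvd int q"
    then have "p dvd 1" using q(2) by (metis coprime_def dvd_refl)
    then show False using prime_p by auto
  qed
  then have "[int q ^ (nat p - 1) = 1] (mod p)"
    using fermat_theorem_int[of "nat p" "int q"] prime_p p_gt_1 by (simp add: prime_nat_iff_prime)
  then have "[(int q ^ (nat p - 1)) ^ k = 1 ^ k] (mod p)"
    by (rule cong_pow)
  then have t: "[int q ^ t = 1] (mod p)"
    by (simp add: t_def power_mult)
  have "\<phi> (int q ^ t * x) = \<phi> x" for x
    using periodicD[OF \<phi> cong_mult[OF t cong_refl[of x]]] by simp
  then have fix_t: "gcong q (emb \<phi>) (emb \<phi> ^ (q ^ t))"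
    using gcong_sym[OF frobenius_iterate[OF q \<phi>, of t]] by simp
  have "1 \<le> nat p - 1" using p_gt_1 by simp
  then have "k \<le> t" using mult_le_mono1[of 1 "nat p - 1" k] by (simp add: t_def)
  also have "t < q ^ t" using prime_gt_1_nat[OF q(1)] by (intro power_gt_expt) simp
  finally have "q ^ t = k + (q ^ t - k)" by simp
  then have "emb \<phi> ^ (q ^ t) = emb \<phi> ^ k * emb \<phi> ^ (q ^ t - k)"
    by (metis power_add)
  also have "gcong q \<dots> (0 * emb \<phi> ^ (q ^ t - k))"
    by (rule gcong_mult[OF 0 gcong_refl])
  finally show ?thesis
    using fix_t gcong_trans by simp
qed

section \<open>Commutativity, the unit element and scaling laws for powers\<close>

lemma conv_commute:
  assumes "periodic \<phi>" "periodic \<psi>"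
  shows "conv \<phi> \<psi> z = conv \<psi> \<phi> z"
proof -
  have "periodic (\<lambda>y. \<psi> y * \<phi> (z - y))"
    by (rule periodicI, rule arg_cong2[where f = "(*)"])
       (rule periodicD[OF assms(2)], assumption, rule periodicD[OF assms(1)], rule cong_diff, simp_all)
  from sum_affine[OF this, of "-1" z] show ?thesis
    by (simp add: conv_def mult.commute)
qed

lemma conv_add_right: "conv \<phi> (\<lambda>x. \<psi> x + \<chi> x) z = conv \<phi> \<psi> z + conv \<phi> \<chi> z"
  by (simp add: conv_def distrib_left sum.distrib)

lemma conv_const: "conv \<phi> (\<lambda>_. c) z = c * (\<Sum>x\<in>{0..<p}. \<phi> x)"
  by (simp add: conv_def sum_distrib_left mult.commute)

definition delta :: "int \<Rightarrow> int" where
  "delta x = of_bool (p dvd x)"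

lemma periodic_delta [intro]: "periodic delta"
  by (rule periodicI) (simp add: delta_def cong_dvd_iff)

lemma emb_delta [simp]: "emb delta = 1"
proof -
  have "emb delta = (\<Sum>x\<in>{0..<p}. if x = 0 then 1 else 0)"
    unfolding emb_def
  proof (rule sum.cong)
    fix x assume "x \<in> {0..<p}"
    then have "p dvd x \<longleftrightarrow> x = 0"
      using zdvd_not_zless[of x p] by fastforce
    then show "smult (delta x) (X x) = (if x = 0 then 1 else 0)"
      by (simp add: delta_def)
  qed simp
  then show ?thesis using p_gt_1 by simp
qed

lemma sum_delta: "(\<Sum>x\<in>{0..<p}. delta x * f x) = f 0"
proof -
  have "(\<Sum>x\<in>{0..<p}. delta x * f x) = (\<Sum>x\<in>{0..<p}. if x = 0 then f 0 else 0)"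
  proof (rule sum.cong)
    fix x assume "x \<in> {0..<p}"
    then have "p dvd x \<longleftrightarrow> x = 0"
      using zdvd_not_zless[of x p] by fastforce
    then show "delta x * f x = (if x = 0 then f 0 else 0)"
      by (simp add: delta_def)
  qed simp
  then show ?thesis using p_gt_1 by simp
qed

lemma power_unit_coprime:
  assumes "[t ^ k = e] (mod p)" "e * e = (1 :: int)" "k > 0"
  shows "coprime t p"
proof -
  have "[t ^ k * t ^ k = 1] (mod p)"
    using cong_mult[OF assms(1,1)] assms(2) by simp
  then have "[t * (t ^ (k - 1) * t ^ k) = 1] (mod p)"
    using assms(3) by (cases k) (simp_all add: mult.assoc)
  then show ?thesis
    by (auto simp: coprime_iff_invertible_int)
qed

text \<open>Here \<open>e\<close> is its own inverse, so it can be moved across the congruence. The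
  cases 1 and -1 yield the scaling laws of \<open>R\<close>, \<open>N\<close> and later
  \<open>D\<close>.\<close>

lemma power_scale_iff:
  assumes "[t ^ k = e] (mod p)" "e * e = (1 :: int)"
  shows "[(t * x) ^ k = c] (mod p) \<longleftrightarrow> [x ^ k = e * c] (mod p)"
proof -
  have e: "coprime e p"
    using assms(2) by (metis coprime_1_left coprime_mult_left_iff)
  have "[(t * x) ^ k = c] (mod p) \<longleftrightarrow> [e * x ^ k = c] (mod p)"
    unfolding power_mult_distrib
    using cong_scalar_right[OF assms(1), of "x ^ k"] by (metis cong_sym cong_trans)
  also have "\<dots> \<longleftrightarrow> [e * (e * x ^ k) = e * c] (mod p)"
    using e by (simp add: cong_mult_lcancel)
  also have "e * (e * x ^ k) = x ^ k"
    using assms(2) by (simp flip: mult.assoc)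
  finally show ?thesis .
qed

end

section \<open>Quadratic residues and nonresidues in the group ring\<close>

locale paley = group_ring +
  fixes M :: nat and g :: int
  assumes p_eq: "p = 4 * int M + 1"
    and g: "[g ^ (2 * M) = - 1] (mod p)"
begin

lemma M_pos: "M > 0"
  using p_eq p_gt_1 by auto

lemma one_not_cong_minus_one: "\<not> [1 = - 1] (mod p)" "\<not> [- 1 = 1] (mod p)"
proof -
  show "\<not> [1 = - 1] (mod p)"
  proof
    assume "[1 = - 1] (mod p)"
    then have "p dvd 2" by (simp add: cong_iff_dvd_diff)
    then have "p \<le> 2" by (rule zdvd_imp_le) simp
    then show False using p_eq M_pos by auto
  qed
  then show "\<not> [- 1 = 1] (mod p)" by (simp add: cong_sym_eq)
qed

lemma power_not_dvd:
  assumes "[x ^ k = e] (mod p)" "e * e = (1 :: int)" "k > 0"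
  shows "\<not> p dvd x"
  using power_unit_coprime[OF assms] p_gt_1
  by (metis coprime_absorb_right not_prime_unit prime_p)

lemma power_half_cases:
  assumes "\<not> p dvd x"
  shows "[x ^ (2 * M) = 1] (mod p) \<or> [x ^ (2 * M) = - 1] (mod p)"
proof -
  have "[x ^ (nat p - 1) = 1] (mod int (nat p))"
    using assms p_gt_1 prime_p by (intro fermat_theorem_int) (auto simp: prime_nat_iff_prime)
  moreover have "nat p - 1 = 2 * M + 2 * M" using p_eq by simp
  ultimately have "[x ^ (2 * M) * x ^ (2 * M) = 1] (mod p)"
    using p_gt_1 by (metis nat_0_le less_imp_le less_trans zero_less_one power_add)
  then have "p dvd (x ^ (2 * M) - 1) * (x ^ (2 * M) + 1)"
    by (simp add: cong_iff_dvd_diff algebra_simps)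
  then have "p dvd x ^ (2 * M) - 1 \<or> p dvd x ^ (2 * M) + 1"
    using prime_p by (simp add: prime_dvd_mult_iff)
  then show ?thesis by (simp add: cong_iff_dvd_diff)
qed

text \<open>Euler's criterion serves as the definition, with 2 M = (p - 1) / 2, so that scaling laws
  are computations with powers. The link to \<open>QuadRes\<close> is
  \<open>QuadRes_iff\<close>.\<close>

definition R :: "int \<Rightarrow> int" where
  "R x = of_bool ([x ^ (2 * M) = 1] (mod p))"

definition N :: "int \<Rightarrow> int" where
  "N x = of_bool ([x ^ (2 * M) = - 1] (mod p))"

lemma periodic_power: "periodic (\<lambda>x. [x ^ k = c] (mod p))"
  by (rule periodicI) (metis cong_pow cong_sym cong_trans)

lemma periodic_R [intro, simp]: "periodic R" and periodic_N [intro, simp]: "periodic N"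
  using periodic_power unfolding R_def N_def periodic_def by simp_all

lemma delta_R_N: "delta x + R x + N x = 1"
proof (cases "p dvd x")
  case True
  then have "\<not> [x ^ (2 * M) = 1] (mod p)" "\<not> [x ^ (2 * M) = - 1] (mod p)"
    using power_not_dvd[of x "2 * M" 1] power_not_dvd[of x "2 * M" "-1"] M_pos by auto
  then show ?thesis using True by (simp add: delta_def R_def N_def)
next
  case False
  then show ?thesis
    using power_half_cases[OF False] one_not_cong_minus_one
    by (auto simp: delta_def R_def N_def dest: cong_trans[OF cong_sym])
qed

lemma residue_scale:
  assumes "[t ^ (2 * M) = 1] (mod p)"
  shows "R (t * x) = R x" "N (t * x) = N x"
  using power_scale_iff[OF assms] by (simp_all add: R_def N_def)

lemma nonresidue_scale:
  assumes "[t ^ (2 * M) = - 1] (mod p)"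
  shows "R (t * x) = N x" "N (t * x) = R x"
  using power_scale_iff[OF assms] by (simp_all add: R_def N_def)

lemma R_minus [simp]: "R (- x) = R x" and N_minus [simp]: "N (- x) = N x"
  using residue_scale[of "-1" x] by simp_all

lemma R_N_0 [simp]: "R 0 = 0" "N 0 = 0"
  using delta_R_N[of 0] by (auto simp: delta_def R_def N_def of_bool_def split: if_splits)

lemma R_1 [simp]: "R 1 = 1" and N_g [simp]: "N g = 1"
  using g by (simp_all add: R_def N_def)

lemma R_g [simp]: "R g = 0"
  using delta_R_N[of g] g by (auto simp: delta_def R_def N_def of_bool_def split: if_splits)

lemma R_mult_N [simp]: "R x * N x = 0"
  using delta_R_N[of x] by (auto simp: delta_def R_def N_def of_bool_def split: if_splits)

lemma coprime_g: "coprime g p"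
  using power_unit_coprime[OF g] M_pos by simp

lemma sum_R: "(\<Sum>x\<in>{0..<p}. R x) = 2 * int M"
  and sum_N: "(\<Sum>x\<in>{0..<p}. N x) = 2 * int M"
proof -
  have "(\<Sum>x\<in>{0..<p}. N x) = (\<Sum>x\<in>{0..<p}. R x)"
    using sum_scale[OF periodic_R coprime_g] by (simp add: nonresidue_scale[OF g])
  moreover have "(\<Sum>x\<in>{0..<p}. delta x + R x + N x) = p"
    using p_gt_1 by (simp add: delta_R_N)
  moreover have "(\<Sum>x\<in>{0..<p}. delta x) = 1"
    using sum_delta[of "\<lambda>_. 1"] by simp
  ultimately show "(\<Sum>x\<in>{0..<p}. R x) = 2 * int M" "(\<Sum>x\<in>{0..<p}. N x) = 2 * int M"
    using p_eq by (simp_all add: sum.distrib)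
qed

text \<open>The nonzero classes form two cosets of the residues, represented by 1 and
  \<open>g\<close>, so an invariant function is determined by its values at 0, 1 and
  \<open>g\<close>.\<close>

lemma class_function:
  assumes per: "periodic \<phi>"
    and inv: "\<And>t x. [t ^ (2 * M) = 1] (mod p) \<Longrightarrow> \<phi> (t * x) = \<phi> x"
  shows "\<phi> x = \<phi> 0 * delta x + \<phi> 1 * R x + \<phi> g * N x"
proof -
  consider "p dvd x" | "[x ^ (2 * M) = 1] (mod p)" | "[x ^ (2 * M) = - 1] (mod p)"
    using power_half_cases by blast
  then show ?thesis
  proof cases
    case 1
    then have "\<phi> x = \<phi> 0"
      by (intro periodicD[OF per]) (simp add: cong_0_iff)
    moreover have "R x = 0" "N x = 0" "delta x = 1"
      using delta_R_N[of x] 1 by (auto simp: delta_def R_def N_def of_bool_def split: if_splits)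
    ultimately show ?thesis by simp
  next
    case 2
    then have "\<phi> x = \<phi> 1" using inv[OF 2, of 1] by simp
    moreover have "R x = 1" "N x = 0" "delta x = 0"
      using delta_R_N[of x] 2 by (auto simp: delta_def R_def N_def of_bool_def split: if_splits)
    ultimately show ?thesis by simp
  next
    case 3
    obtain t where t: "[t * g = x] (mod p)"
      using coprime_g cong_solve_dvd_int[of g p]
      by (metis cong_scalar_left cong_solve_coprime_int mult.assoc mult.commute mult.right_neutral)
    have "[(g * t) ^ (2 * M) = - 1] (mod p)"
      using 3 cong_pow[OF t, of "2 * M"] by (metis cong_trans mult.commute)
    then have "[t ^ (2 * M) = 1] (mod p)"
      using power_scale_iff[OF g, of t "-1"] by simp
    from inv[OF this, of g] periodicD[OF per t] have "\<phi> x = \<phi> g" by simp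
    moreover have "R x = 0" "N x = 1" "delta x = 0"
      using delta_R_N[of x] 3 by (auto simp: delta_def R_def N_def of_bool_def split: if_splits)
    ultimately show ?thesis by simp
  qed
qed

text \<open>The convolution is invariant under residues. It vanishes at 0 because -1 is a residue,
  and its values at 1 and \<open>g\<close> agree because dilation by \<open>g\<close> swaps
  \<open>R\<close> and \<open>N\<close>. The total (2 M)^2 is thus spread evenly over 4 M
  classes.\<close>

lemma conv_R_N: "conv R N x = int M * (R x + N x)"
proof -
  have cop: "coprime t p" if "[t ^ (2 * M) = 1] (mod p)" for t
    using power_unit_coprime[OF that] M_pos by simp
  have "conv R N (t * x) = conv R N x" if "[t ^ (2 * M) = 1] (mod p)" for t x
    using conv_scale[OF periodic_R periodic_N cop[OF that], of x] by (simp add: residue_scale[OF that])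
  then have *: "conv R N x = conv R N 0 * delta x + conv R N 1 * R x + conv R N g * N x" for x
    by (rule class_function[OF periodic_conv[OF periodic_N]])
  have 0: "conv R N 0 = 0"
    by (simp add: conv_def)
  have "conv R N (g * 1) = conv N R 1"
    using conv_scale[OF periodic_R periodic_N coprime_g, of 1] by (simp add: nonresidue_scale[OF g])
  then have 1: "conv R N g = conv R N 1"
    using conv_commute[OF periodic_R periodic_N] by simp
  have "2 * int M * (2 * int M) = (\<Sum>x\<in>{0..<p}. conv R N x)"
    using sum_conv[OF periodic_N, of R] by (simp add: sum_R sum_N)
  also have "\<dots> = (\<Sum>x\<in>{0..<p}. conv R N 1 * (R x + N x))"
    by (intro sum.cong refl) (subst *, simp add: 0 1 distrib_left)
  also have "\<dots> = conv R N 1 * (4 * int M)"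
    by (simp add: sum_R sum_N sum.distrib flip: sum_distrib_left)
  finally have "conv R N 1 = int M" using M_pos by simp
  then show ?thesis by (subst *) (simp add: 0 1 distrib_left)
qed

text \<open>Convolving \<open>R\<close> with the constant \<open>delta + R + N = 1\<close> gives 2 M
  everywhere; subtract the parts from \<open>delta\<close> and \<open>N\<close>.\<close>

lemma conv_R_R: "conv R R x = 2 * int M - int M * (R x + N x) - R x"
proof -
  have "conv R delta x = conv delta R x"
    by (rule conv_commute) auto
  also have "\<dots> = R x"
    by (simp add: conv_def sum_delta)
  finally have "conv R (\<lambda>x. delta x + R x + N x) x = R x + conv R R x + int M * (R x + N x)"
    by (simp add: conv_add_right conv_R_N)
  then show ?thesis
    by (simp add: delta_R_N conv_const sum_R)
qed

lemma QuadRes_iff: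
  assumes "\<not> p dvd x"
  shows "QuadRes p x \<longleftrightarrow> [x ^ (2 * M) = 1] (mod p)"
proof -
  have "(nat p - 1) div 2 = 2 * M" "2 < nat p"
    using p_eq M_pos by auto
  then have "[Legendre x p = x ^ (2 * M)] (mod p)"
    using euler_criterion[of "nat p" x] prime_p p_gt_1 by (simp add: prime_nat_iff_prime)
  moreover have "Legendre x p = (if QuadRes p x then 1 else - 1)"
    using assms by (simp add: Legendre_def cong_0_iff)
  ultimately show ?thesis
    using one_not_cong_minus_one by (metis cong_sym cong_trans)
qed

lemma mem_QR_set_iff: "x mod p \<in> QR_set p \<longleftrightarrow> R x = 1"
proof (cases "p dvd x")
  case True
  then show ?thesis
    using delta_R_N[of x] by (auto simp: QR_set_def delta_def R_def N_def of_bool_def split: if_splits)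
next
  case False
  then have "0 < x mod p" "x mod p < p" "\<not> p dvd x mod p"
    using p_gt_1 pos_mod_sign[of p x] by (auto simp: dvd_mod_iff dvd_eq_mod_eq_0 order_le_less)
  then show ?thesis
    using periodicD[OF periodic_power[of "2 * M" 1], of "x mod p" x] QuadRes_iff[of "x mod p"]
    by (auto simp: QR_set_def R_def)
qed

end

section \<open>The set A and its dilate by a nonresidue\<close>

locale paley_difference = paley +
  fixes A :: "int set"
  assumes A_subset: "A \<subseteq> {0..<p}"
    and exact: "diff_exact p A (QR_set p)"
begin

definition a :: "int \<Rightarrow> int" where
  "a x = of_bool (x mod p \<in> A)"

lemma periodic_a [intro, simp]: "periodic a"
  by (simp add: a_def periodic_def)

lemma finite_A: "finite A"
  using A_subset finite_subset by blast

lemma A_mod [simp]: "x \<in> A \<Longrightarrow> x mod p = x"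
  using A_subset by auto

lemma R_diff: "x \<in> A \<Longrightarrow> y \<in> A \<Longrightarrow> x \<noteq> y \<Longrightarrow> R (x - y) = 1"
  using exact mem_QR_set_iff unfolding diff_exact_def by blast

lemma sum_a_mult: "(\<Sum>x\<in>{0..<p}. a x * f x) = (\<Sum>x\<in>A. f x)"
proof -
  have "(\<Sum>x\<in>{0..<p}. a x * f x) = (\<Sum>x\<in>A. a x * f x)"
    using A_subset by (intro sum.mono_neutral_right) (auto simp: a_def)
  then show ?thesis by (simp add: a_def)
qed

lemma sum_a: "(\<Sum>x\<in>{0..<p}. a x) = int (card A)"
  using sum_a_mult[of "\<lambda>_. 1"] by simp

text \<open>The hypothesis on \<open>A\<close> in group ring form: the convolution counts the
  representations of \<open>z\<close> as a difference in \<open>A\<close>.\<close>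

lemma conv_a_minus: "conv a (\<lambda>x. a (- x)) z = int (card A) * delta z + R z"
proof -
  \<comment> \<open>First components of the representations of \<open>z\<close>; the second
    component is \<open>(y - z) mod p\<close>.\<close>
  define B where "B = {y \<in> A. (y - z) mod p \<in> A}"
  have "conv a (\<lambda>x. a (- x)) z = (\<Sum>y\<in>A. a (y - z))"
    by (simp add: conv_def sum_a_mult)
  also have "\<dots> = int (card B)"
    using finite_A by (simp add: a_def B_def Int_def)
  finally have *: "conv a (\<lambda>x. a (- x)) z = int (card B)" .
  consider "p dvd z" | "[z ^ (2 * M) = 1] (mod p)" | "[z ^ (2 * M) = - 1] (mod p)"
    using power_half_cases by blast
  then show ?thesis
  proof cases
    case 1
    then have "(y - z) mod p = y mod p" for y
      by (simp add: mod_eq_dvd_iff)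
    then have "B = A" by (auto simp: B_def)
    moreover have "R z = 0" "delta z = 1"
      using delta_R_N[of z] 1 by (auto simp: delta_def R_def N_def of_bool_def split: if_splits)
    ultimately show ?thesis using * by simp
  next
    case 2
    then have R: "R z = 1" "delta z = 0"
      using delta_R_N[of z] by (auto simp: delta_def R_def N_def of_bool_def split: if_splits)
    then have "\<exists>!x. fst x \<in> A \<and> snd x \<in> A \<and> (fst x - snd x) mod p = z mod p"
      using exact mem_QR_set_iff[of z] unfolding diff_exact_def by blast
    then obtain x where x: "fst x \<in> A" "snd x \<in> A" "(fst x - snd x) mod p = z mod p"
      and uniq: "\<And>x'. fst x' \<in> A \<and> snd x' \<in> A \<and> (fst x' - snd x') mod p = z mod p \<Longrightarrow> x' = x"
      by blast
    have "B = {fst x}"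
    proof (intro equalityI subsetI)
      fix y assume y: "y \<in> B"
      have "(y - (y - z) mod p) mod p = z mod p"
        by (simp add: mod_diff_right_eq)
      then show "y \<in> {fst x}"
        using y uniq[of "(y, (y - z) mod p)"] by (auto simp: B_def)
    next
      fix y assume "y \<in> {fst x}"
      moreover have "[fst x - (fst x - snd x) = fst x - z] (mod p)"
        using x(3) by (intro cong_diff) (auto simp: cong_def)
      then have "(fst x - z) mod p = snd x"
        using x(2) by (simp add: cong_def)
      ultimately show "y \<in> B"
        using x by (simp add: B_def)
    qed
    then show ?thesis using * R by simp
  next
    case 3
    then have R: "R z = 0" "delta z = 0"
      using delta_R_N[of z] by (auto simp: delta_def R_def N_def of_bool_def split: if_splits)
    have "B = {}"
    proof (rule ccontr)
      assume "B \<noteq> {}"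
      then obtain y where y: "y \<in> A" "(y - z) mod p \<in> A" by (auto simp: B_def)
      have c: "[y - (y - z) mod p = z] (mod p)"
        by (simp add: cong_def mod_diff_right_eq)
      have "\<not> p dvd z" using R by (auto simp: delta_def)
      then have "y \<noteq> (y - z) mod p"
        using c by (metis cong_0_iff cong_sym diff_self)
      moreover have "R (y - (y - z) mod p) = R z"
        by (rule periodicD[OF periodic_R c])
      ultimately show False using R_diff[OF y] R by simp
    qed
    then show ?thesis using * R by simp
  qed
qed

lemma card_A_eq: "int (card A) * (int (card A) - 1) = 2 * int M"
proof -
  have "periodic (\<lambda>x. a (- x))"
    using periodic_scale[OF periodic_a, of "-1"] by simp
  moreover from sum_scale[OF periodic_a, of "-1"] have "(\<Sum>x\<in>{0..<p}. a (- x)) = int (card A)"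
    by (simp add: sum_a)
  ultimately have "int (card A) * int (card A) = (\<Sum>z\<in>{0..<p}. conv a (\<lambda>x. a (- x)) z)"
    by (simp add: sum_conv sum_a)
  also have "\<dots> = int (card A) * (\<Sum>z\<in>{0..<p}. delta z * 1) + (\<Sum>z\<in>{0..<p}. R z)"
    by (simp add: conv_a_minus sum.distrib sum_distrib_left)
  also have "\<dots> = int (card A) + 2 * int M"
    using sum_delta[of "\<lambda>_. 1"] by (simp add: sum_R)
  finally show ?thesis by (simp add: algebra_simps)
qed

text \<open>Two different contributions \<open>x\<close>, \<open>y\<close> would make both
  \<open>x - y\<close> and \<open>g * (x - y)\<close> differences of distinct elements of
  \<open>A\<close>, hence both residues, although \<open>g\<close> is a nonresidue.\<close>

lemma conv_a_scaled_01: "conv a (\<lambda>x. a (g * x)) z \<in> {0, 1}"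
proof -
  define B where "B = {y \<in> A. (g * (z - y)) mod p \<in> A}"
  have "conv a (\<lambda>x. a (g * x)) z = (\<Sum>y\<in>A. a (g * (z - y)))"
    by (simp add: conv_def sum_a_mult)
  also have "\<dots> = int (card B)"
    using finite_A by (simp add: a_def B_def Int_def)
  finally have *: "conv a (\<lambda>x. a (g * x)) z = int (card B)" .
  have "x = y" if xy: "x \<in> B" "y \<in> B" for x y
  proof (rule ccontr)
    assume ne: "x \<noteq> y"
    then have "R (x - y) = 1" using xy R_diff by (simp add: B_def)
    then have N: "N (g * (x - y)) = 1" by (simp add: nonresidue_scale[OF g])
    define u v where "u = (g * (z - y)) mod p" and "v = (g * (z - x)) mod p"
    have "[u - v = g * (z - y) - g * (z - x)] (mod p)"
      unfolding u_def v_def by (intro cong_diff) auto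
    then have c: "[u - v = g * (x - y)] (mod p)"
      by (simp add: algebra_simps)
    then have N': "N (u - v) = 1" using N periodicD[OF periodic_N c] by simp
    then have "u \<noteq> v" by auto
    then have "R (u - v) = 1" using xy R_diff by (simp add: B_def u_def v_def)
    then show False using N' R_mult_N[of "u - v"] by simp
  qed
  moreover have "finite B" using finite_A by (simp add: B_def)
  ultimately have "card B \<le> 1"
    by (simp add: card_le_Suc0_iff_eq)
  then show ?thesis using * by auto
qed

text \<open>\<open>T\<close> is the annihilator and \<open>T'\<close> its dilate by
  \<open>g\<close>, which treats \<open>R\<close> and \<open>N\<close> together. Dilating the
  assumption shows that \<open>T'\<close> annihilates the dilate \<open>b\<close> of
  \<open>a\<close>.\<close>

lemma annihilation_contradiction:
  assumes q: "prime q" "coprime (int q) p"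
    and T: "(T, T') = (R, N) \<or> (T, T') = (N, R)"
    and 0: "gcong q (emb a * emb T) 0"
  shows False
proof -
  define b where "b = (\<lambda>x. a (g * x))"
  have b: "periodic b" unfolding b_def by auto
  have T_per: "periodic T" "periodic T'" and T_g: "T (g * x) = T' x" for x
    using T nonresidue_scale[OF g] by auto
  have 1: "gcong q (emb (conv a T)) 0"
    using gcong_trans[OF gcong_sym[OF emb_mult[OF T_per(1)]] 0] .
  have dvd: "int q dvd conv a T x" for x
    using dvd_of_gcong_emb_0[OF 1, of "x mod p"] periodic_conv[OF T_per(1)] p_gt_1
    by (simp add: periodic_def)
  have "conv b T' x = conv a T (g * x)" for x
    using conv_scale[OF periodic_a T_per(1) coprime_g] by (simp add: b_def T_g)
  then have "gcong q (emb (conv b T')) (emb (\<lambda>_. 0))"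
    using dvd by (intro gcong_emb) (simp add: cong_0_iff)
  then have 2: "gcong q (emb b * emb T') 0"
    using gcong_trans[OF emb_mult[OF T_per(2)]] by (simp add: emb_def)
  define c where "c = conv a b"
  have c_per: "periodic c" unfolding c_def using b by auto
  have c_sum: "(\<Sum>z\<in>{0..<p}. c z) = int (card A) * int (card A)"
    using sum_scale[OF periodic_a coprime_g] sum_conv[OF b, of a] by (simp add: c_def sum_a b_def)
  have "gcong q (emb c) (emb a * emb b)"
    unfolding c_def by (rule gcong_sym[OF emb_mult[OF b]])
  \<comment> \<open>The subtracted terms vanish by the two annihilations, and 1 + T + T' is the sum
    of all group elements, whose multiples are constant.\<close>
  also have "emb a * emb b = emb a * emb b * (1 + emb T + emb T')
      - (emb a * emb T * emb b + emb a * (emb b * emb T'))"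
    by (simp add: algebra_simps)
  also have "gcong q \<dots> (emb c * emb (\<lambda>_. 1) - (0 * emb b + emb a * 0))"
  proof (intro gcong_diff gcong_add gcong_mult gcong_refl 0 2)
    show "gcong q (emb a * emb b) (emb c)"
      unfolding c_def by (rule emb_mult[OF b])
    have "1 + emb T + emb T' = emb (\<lambda>x. delta x + R x + N x)"
      using T by (auto simp: emb_add)
    then show "gcong q (1 + emb T + emb T') (emb (\<lambda>_. 1))"
      by (simp add: delta_R_N)
  qed
  also have "emb c * emb (\<lambda>_. 1) - (0 * emb b + emb a * 0) = emb c * emb (\<lambda>_. 1)"
    by simp
  also have "gcong q \<dots> (emb (conv c (\<lambda>_. 1)))"
    by (rule emb_mult) (simp add: periodic_def)
  also have "conv c (\<lambda>_. 1) = (\<lambda>_. int (card A) * int (card A))"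
    by (simp add: conv_const c_sum fun_eq_iff)
  finally have gc: "gcong q (emb c) (emb (\<lambda>_. int (card A) * int (card A)))" .
  have "[c x = int (card A) * int (card A)] (mod int q)" for x
    using gcong_embD[OF gc c_per, of x] by (simp add: periodic_def)
  then have cong: "[c x = c 0] (mod int q)" for x
    by (metis cong_sym cong_trans)
  have c01: "c x \<in> {0, 1}" for x
    using conv_a_scaled_01 by (simp add: c_def b_def)
  have "c x = c 0" for x
  proof (rule ccontr)
    assume "c x \<noteq> c 0"
    then have "\<bar>c x - c 0\<bar> = 1" using c01[of x] c01[of 0] by auto
    moreover have "int q dvd \<bar>c x - c 0\<bar>" using cong[of x] by (simp add: cong_iff_dvd_diff)
    ultimately show False using prime_gt_1_nat[OF q(1)] by simp
  qed
  then have "(\<Sum>z\<in>{0..<p}. c z) = (\<Sum>z\<in>{0..<p}. c 0)"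
    by (intro sum.cong) auto
  also have "\<dots> = p * c 0"
    using p_gt_1 by simp
  finally have "(\<Sum>z\<in>{0..<p}. c z) = p * c 0" .
  \<comment> \<open>A constant function with value 0 or 1 has sum 0 or \<open>p\<close>, but the sum
    of \<open>c\<close> is the square of \<open>card A\<close>, and a prime is not a square.\<close>
  then have sq: "int (card A) * int (card A) = p * c 0"
    using c_sum by simp
  moreover have "card A \<noteq> 0"
    using card_A_eq M_pos by (cases "card A") auto
  ultimately have "int (card A) * int (card A) = p"
    using c01[of 0] by auto
  then have sq: "p = int (card A) * int (card A)" ..
  then have "int (card A) dvd p" by simp
  moreover have "\<forall>d\<ge>0. d dvd p \<longrightarrow> d = 1 \<or> d = p"
    using prime_p prime_int_iff by blast
  ultimately have "int (card A) = 1 \<or> int (card A) = p"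
    using of_nat_0_le_iff by blast
  then show False using sq p_gt_1 by auto
qed

end

section \<open>Prime divisors of M have odd order modulo p\<close>

lemma power_eq_1_of_prime_divisors:
  fixes n m :: nat and p :: int
  assumes "n > 0" "\<And>q. prime q \<Longrightarrow> q dvd n \<Longrightarrow> [int q ^ m = 1] (mod p)"
  shows "[int n ^ m = 1] (mod p)"
  using assms
proof (induction n rule: less_induct)
  case (less n)
  show ?case
  proof (cases "n = 1")
    case False
    then obtain q where q: "prime q" "q dvd n" using prime_factor_nat by blast
    then obtain k where k: "n = q * k" by auto
    have "k < n" "k > 0" using k less.prems(1) prime_gt_1_nat[OF q(1)] by auto
    then have "[int k ^ m = 1] (mod p)"
      using less.IH[of k] less.prems(2) k by auto
    then show ?thesis
      using cong_mult[OF less.prems(2)[OF q]] by (simp add: k power_mult_distrib)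
  qed simp
qed

context paley
begin

lemma emb_R_N:
  assumes "q dvd M"
  shows "gcong q (emb R * emb N) 0"
proof -
  have "gcong q (emb R * emb N) (emb (conv R N))"
    by (rule emb_mult) simp
  also have "gcong q \<dots> (emb (\<lambda>_. 0))"
    using assms by (intro gcong_emb) (simp add: conv_R_N cong_0_iff)
  finally show ?thesis by (simp add: emb_def)
qed

lemma emb_R_R:
  assumes "q dvd M"
  shows "gcong q (emb R * emb R) (- emb R)"
proof -
  have "gcong q (emb R * emb R) (emb (conv R R))"
    by (rule emb_mult) simp
  also have "gcong q \<dots> (emb (\<lambda>x. - 1 * R x))"
    using assms by (intro gcong_emb) (simp add: conv_R_R cong_iff_dvd_diff flip: left_diff_distrib)
  finally show ?thesis by (simp only: emb_mult_const) simp
qed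

lemma coprime_divisor:
  assumes "q dvd M"
  shows "coprime (int q) p"
proof -
  have "is_unit d" if "d dvd int q" "d dvd p" for d
  proof -
    have "d dvd 4 * int M"
      using that(1) assms by (meson dvd_mult dvd_trans int_dvd_int_iff)
    then have "d dvd p - 4 * int M" using that(2) by (rule dvd_diff[rotated])
    then show ?thesis by (simp add: p_eq)
  qed
  then show ?thesis by (rule coprimeI)
qed

end

context paley_difference
begin

text \<open>Since \<open>q\<close> divides n (n - 1) for n = \<open>card A\<close>, the element n +
  R reduces to R or to 1 + R, annihilated by \<open>N\<close> and by \<open>R\<close>
  respectively.\<close>

lemma no_power_minus_one:
  assumes q: "prime q" "q dvd M"
  shows "\<not> [int q ^ j = - 1] (mod p)"
proof
  assume j: "[int q ^ j = - 1] (mod p)"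
  note cop = coprime_divisor[OF q(2)]
  let ?n = "int (card A)"
  \<comment> \<open>As q^j is -1 modulo \<open>p\<close>, Frobenius sends \<open>a\<close> to its
    reflection under the power q^j; one more factor gives n + R.\<close>
  define k where "k = Suc (q ^ j)"
  have a': "periodic (\<lambda>x. a (- x))"
    using periodic_scale[OF periodic_a, of "-1"] by simp
  have "a (- (int q ^ j * x)) = a x" for x
    using cong_mult[OF j cong_refl[of "- x"]] by (intro periodicD[OF periodic_a]) simp
  then have "gcong q (emb a ^ (q ^ j)) (emb (\<lambda>x. a (- x)))"
    using frobenius_iterate[OF q(1) cop a', of j] by simp
  then have "gcong q (emb a ^ k) (emb a * emb (\<lambda>x. a (- x)))"
    unfolding k_def power_Suc by (rule gcong_mult[OF gcong_refl])
  also have "gcong q \<dots> (emb (conv a (\<lambda>x. a (- x))))"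
    by (rule emb_mult[OF a'])
  also have "conv a (\<lambda>x. a (- x)) = (\<lambda>z. ?n * delta z + R z)"
    by (simp add: conv_a_minus fun_eq_iff)
  also have "emb \<dots> = smult ?n 1 + emb R"
    by (simp add: emb_add emb_mult_const)
  finally have ak: "gcong q (emb a ^ k) (smult ?n 1 + emb R)" .
  \<comment> \<open>From A^k T = 0, multiplying by T^(k - 1) gives (A T)^k = 0, and reducedness
    removes the power.\<close>
  have reduce: "gcong q (emb a * emb T) 0"
    if T: "periodic T" and 0: "gcong q ((smult ?n 1 + emb R) * emb T) 0" for T
  proof -
    have "gcong q (emb a ^ k * emb T) 0"
      using gcong_trans[OF gcong_mult[OF ak gcong_refl] 0] .
    then have "gcong q (emb a ^ k * emb T * emb T ^ (q ^ j)) (0 * emb T ^ (q ^ j))"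
      by (rule gcong_mult[OF _ gcong_refl])
    then have "gcong q ((emb a * emb T) ^ k) 0"
      by (simp add: power_mult_distrib k_def mult_ac)
    then have "gcong q (emb (conv a T) ^ k) 0"
      using gcong_trans[OF gcong_power[OF gcong_sym[OF emb_mult[OF T]]]] by blast
    then have "gcong q (emb (conv a T)) 0"
      using gcong_0_of_power[OF q(1) cop] T by blast
    then show ?thesis
      using gcong_trans[OF emb_mult[OF T]] by blast
  qed
  have n_cong: "gcong q (smult ?n 1 + emb R) (smult c 1 + emb R)" if "[?n = c] (mod int q)" for c
    using that by (intro gcong_add gcong_smult_left gcong_refl)
  have "int q dvd ?n * (?n - 1)"
    unfolding card_A_eq using q(2) by auto
  then have "int q dvd ?n \<or> int q dvd ?n - 1"
    using q(1) by (simp add: prime_dvd_mult_iff)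
  then show False
  proof
    assume "int q dvd ?n"
    then have "gcong q ((smult ?n 1 + emb R) * emb N) ((smult 0 1 + emb R) * emb N)"
      by (intro gcong_mult n_cong) (simp_all add: cong_0_iff)
    also have "gcong q \<dots> 0"
      using emb_R_N[OF q(2)] by simp
    finally show False
      using reduce[OF periodic_N] annihilation_contradiction[OF q(1) cop] by blast
  next
    assume "int q dvd ?n - 1"
    then have "gcong q ((smult ?n 1 + emb R) * emb R) ((smult 1 1 + emb R) * emb R)"
      by (intro gcong_mult n_cong) (simp_all add: cong_iff_dvd_diff)
    also have "(smult 1 1 + emb R) * emb R = emb R + emb R * emb R"
      by (simp add: algebra_simps)
    also have "gcong q \<dots> (emb R + - emb R)"
      by (intro gcong_add gcong_refl emb_R_R[OF q(2)])
    finally have "gcong q ((smult ?n 1 + emb R) * emb R) 0" by simp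
    then show False
      using reduce[OF periodic_R] annihilation_contradiction[OF q(1) cop] by blast
  qed
qed

text \<open>Start from Fermat's exponent p - 1 = 2^K m and halve it \<open>K\<close> times: each
  square root of 1 is 1 or -1, and -1 is excluded by \<open>no_power_minus_one\<close>.\<close>

lemma prime_divisor_odd_order:
  assumes q: "prime q" "q dvd M" and "4 * M = 2 ^ K * m"
  shows "[int q ^ m = 1] (mod p)"
proof -
  have step: "[int q ^ m = 1] (mod p)" if "[int q ^ (2 ^ K * m) = 1] (mod p)" for K
    using that
  proof (induction K)
    case (Suc K)
    define y where "y = int q ^ (2 ^ K * m)"
    have "2 ^ Suc K * m = 2 ^ K * m + 2 ^ K * m" by simp
    then have "[y * y = 1] (mod p)"
      using Suc.prems by (simp only: y_def power_add)
    then have "p dvd (y - 1) * (y + 1)"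
      by (simp add: cong_iff_dvd_diff algebra_simps)
    then have "p dvd y - 1 \<or> p dvd y + 1"
      using prime_p by (simp add: prime_dvd_mult_iff)
    then have "[y = 1] (mod p) \<or> [y = - 1] (mod p)"
      by (simp add: cong_iff_dvd_diff)
    then show ?case
      using no_power_minus_one[OF q] Suc.IH by (auto simp: y_def)
  qed simp
  have "\<not> p dvd int q"
    using coprime_divisor[OF q(2)] prime_p by (metis coprime_def dvd_refl not_prime_unit)
  then have "[int q ^ (nat p - 1) = 1] (mod p)"
    using fermat_theorem_int[of "nat p" "int q"] prime_p p_gt_1 by (simp add: prime_nat_iff_prime)
  also have "nat p - 1 = 2 ^ K * m"
    using p_eq assms(3) by simp
  finally show ?thesis by (rule step)
qed

lemma sum_two_squares_card: "p = int (card A) ^ 2 + int (card A - 1) ^ 2"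
proof -
  have "card A > 0"
    using card_A_eq M_pos by (cases "card A") auto
  then show ?thesis
    using card_A_eq by (simp add: p_eq of_nat_diff power2_eq_square algebra_simps)
qed

lemma card_product: "card A * (card A - 1) = 2 * M"
proof -
  have "card A > 0"
    using card_A_eq M_pos by (cases "card A") auto
  then have "int (card A * (card A - 1)) = int (2 * M)"
    using card_A_eq by (simp add: of_nat_diff)
  then show ?thesis by (simp only: of_nat_eq_iff)
qed

text \<open>Otherwise \<open>card A\<close> and \<open>card A - 1\<close> are products of primes
  dividing \<open>M\<close>, so both have \<open>m\<close>-th power 1 for the odd part
  \<open>m\<close> of p - 1. Raising n^2 = - (n - 1)^2 to the odd power \<open>m\<close> gives 1 =
  -1.\<close>

lemma odd_M: "odd M"
proof
  assume "even M"
  obtain m where Km: "4 * M = 2 ^ multiplicity 2 (4 * M) * m" and "odd m"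
    using multiplicity_decompose'[of "4 * M" 2] M_pos by auto
  have unit: "[int d ^ m = 1] (mod p)" if "d = card A \<or> d = card A - 1" for d
  proof (rule power_eq_1_of_prime_divisors)
    show "d > 0" using card_product M_pos that by (metis bot_nat_0.not_eq_extremum mult_0 mult_0_right nat_0_less_mult_iff zero_less_numeral)
    fix q assume q: "prime q" "q dvd d"
    then have "q dvd 2 * M" using that card_product by (metis dvd_mult dvd_mult2)
    \<comment> \<open>The assumption that \<open>M\<close> is even is needed for
      \<open>q = 2\<close>.\<close>
    then have "q dvd M"
      using q \<open>even M\<close> by (metis prime_dvd_mult_iff primes_dvd_imp_eq two_is_prime_nat)
    then show "[int q ^ m = 1] (mod p)"
      using prime_divisor_odd_order[OF q(1) _ Km] by blast
  qed
  have "[int (card A) ^ 2 = - (int (card A - 1) ^ 2)] (mod p)"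
    using sum_two_squares_card by (simp add: cong_iff_dvd_diff)
  then have "[(int (card A) ^ 2) ^ m = (- (int (card A - 1) ^ 2)) ^ m] (mod p)"
    by (rule cong_pow)
  then have "[(int (card A) ^ m) ^ 2 = - ((int (card A - 1) ^ m) ^ 2)] (mod p)"
    using \<open>odd m\<close> by (simp add: power_minus_odd power_mult[symmetric] mult.commute)
  moreover have "[(int (card A) ^ m) ^ 2 = 1 ^ 2] (mod p)" "[(int (card A - 1) ^ m) ^ 2 = 1 ^ 2] (mod p)"
    by (intro cong_pow unit; simp)+
  ultimately have "[1 = - 1] (mod p)"
    by (metis cong_minus_minus_iff cong_sym cong_trans one_power2)
  then show False using one_not_cong_minus_one by blast
qed

text \<open>As M = (p - 1) / 4, the second conclusion says that \<open>q\<close> is a fourth power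
  modulo \<open>p\<close>; this will make \<open>D\<close> invariant under dilation by
  \<open>q\<close>.\<close>

lemma odd_prime_divisor_quartic:
  assumes "prime q" "odd q" "q dvd card A \<or> q dvd card A - 1"
  shows "q dvd M" "[int q ^ M = 1] (mod p)"
proof -
  have "q dvd 2 * M" using assms(3) card_product by (metis dvd_mult dvd_mult2)
  then show "q dvd M"
    using assms(1,2) by (metis prime_dvd_mult_iff primes_dvd_imp_eq two_is_prime_nat dvd_refl)
  then show "[int q ^ M = 1] (mod p)"
    using prime_divisor_odd_order[OF assms(1), of 2 M] by simp
qed

end

section \<open>Uniqueness of sums of two squares, and the quadratic character of 2\<close>

lemma odd_even_two_squares_unique:
  fixes a b c d p :: int
  assumes p: "prime p" and ab: "p = a\<^sup>2 + b\<^sup>2" and cd: "p = c\<^sup>2 + d\<^sup>2"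
    and par: "odd a" "odd c" "even b" "even d"
  shows "a\<^sup>2 = c\<^sup>2" "b\<^sup>2 = d\<^sup>2"
proof -
  \<comment> \<open>A nonzero multiple of \<open>p\<close> already has square at least p^2, leaving
    no room for the odd, hence nonzero, \<open>y\<close>.\<close>
  have small: "x = 0" if "p dvd x" "x\<^sup>2 + y\<^sup>2 = p\<^sup>2" "odd y" for x y
  proof (rule ccontr)
    assume "x \<noteq> 0"
    then have "\<bar>p\<bar> \<le> \<bar>x\<bar>" using that(1) dvd_imp_le_int by blast
    then have "p\<^sup>2 \<le> x\<^sup>2" by (simp add: abs_le_square_iff)
    moreover have "y\<^sup>2 > 0" using that(3) by (metis even_zero zero_less_power2)
    ultimately show False using that(2) by linarith
  qed
  have "(a * d - b * c) * (a * d + b * c) = p * d\<^sup>2 - p * b\<^sup>2"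
    unfolding ab by (subst cd[unfolded ab]) (simp add: power2_eq_square algebra_simps)
  then have prod: "(a * d - b * c) * (a * d + b * c) = p * (d\<^sup>2 - b\<^sup>2)"
    by (simp add: algebra_simps)
  then have "p dvd a * d - b * c \<or> p dvd a * d + b * c"
    using p by (metis dvd_triv_left prime_dvd_mult_iff)
  \<comment> \<open>Both forms of the two-squares product identity. The parities make
    \<open>a * c + b * d\<close> and \<open>a * c - b * d\<close> odd, so \<open>small\<close>
    applies to whichever of the other terms \<open>p\<close> divides.\<close>
  moreover have "(a * d - b * c)\<^sup>2 + (a * c + b * d)\<^sup>2 = (a\<^sup>2 + b\<^sup>2) * (c\<^sup>2 + d\<^sup>2)"
    "(a * d + b * c)\<^sup>2 + (a * c - b * d)\<^sup>2 = (a\<^sup>2 + b\<^sup>2) * (c\<^sup>2 + d\<^sup>2)"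
    by (simp_all add: power2_eq_square algebra_simps)
  then have "(a * d - b * c)\<^sup>2 + (a * c + b * d)\<^sup>2 = p\<^sup>2"
    "(a * d + b * c)\<^sup>2 + (a * c - b * d)\<^sup>2 = p\<^sup>2"
    by (simp_all only: ab[symmetric] cd[symmetric] power2_eq_square[of p])
  moreover have "odd (a * c + b * d)" "odd (a * c - b * d)" using par by auto
  ultimately have "a * d - b * c = 0 \<or> a * d + b * c = 0" using small by blast
  then have "p * (d\<^sup>2 - b\<^sup>2) = 0" using prod by auto
  then show "b\<^sup>2 = d\<^sup>2" using p by auto
  then show "a\<^sup>2 = c\<^sup>2" using ab cd by linarith
qed

text \<open>Gauss's lemma for the multiplier 2: with h = (q - 1) / 2, the doubles of 1, ..., h that
  exceed h come from the numbers above h / 2, and they are already reduced modulo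
  \<open>q\<close>.\<close>

lemma two_power_half_cong:
  assumes "prime q" "odd q"
  shows "[2 ^ ((q - 1) div 2) = (- 1) ^ ((q - 1) div 2 - (q - 1) div 4)] (mod int q)"
proof -
  have q2: "2 < q" using assms by (metis odd_numeral_BitM odd_one One_nat_def prime_ge_2_nat le_neq_implies_less even_numeral)
  interpret GAUSS q 2
    using assms q2 by unfold_locales (auto simp: cong_0_iff dest: zdvd_imp_le)
  define h where "h = (q - 1) div 2"
  have qh: "q = 2 * h + 1" using assms(2) by (auto simp: h_def elim: oddE)
  have h: "(int q - 1) div 2 = int h" by (simp add: qh)
  have "E = (\<lambda>x. 2 * x) ` {int (h div 2) <.. int h}"
  proof (intro equalityI subsetI)
    fix y assume "y \<in> E"
    then obtain x where x: "0 < x" "x \<le> int h" "y = (x * 2) mod int q" "int h < y"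
      by (auto simp: E_def C_def B_def A_def h)
    moreover have "(x * 2) mod int q = x * 2" using x qh by (intro mod_pos_pos_trivial) auto
    ultimately show "y \<in> (\<lambda>x. 2 * x) ` {int (h div 2) <.. int h}" by (auto simp: image_iff)
  next
    fix y assume "y \<in> (\<lambda>x. 2 * x) ` {int (h div 2) <.. int h}"
    then obtain x where x: "int (h div 2) < x" "x \<le> int h" "y = 2 * x" by auto
    then have "0 < x" "int h < y" by linarith+
    moreover have "y = (x * 2) mod int q" using x calculation qh by (simp add: mod_pos_pos_trivial)
    ultimately show "y \<in> E" using x by (auto simp: E_def C_def B_def A_def h)
  qed
  then have "card E = h - h div 2"
    by (simp add: card_image inj_on_def nat_diff_distrib flip: of_nat_diff)
  moreover have "h div 2 = (q - 1) div 4" by (simp add: h_def flip: div_mult2_eq)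
  moreover have "nat ((int q - 1) div 2) = h" by (simp add: h)
  ultimately show ?thesis
    using pre_gauss_lemma by (simp add: h_def)
qed

section \<open>The signed indicator of quartic residues\<close>

context paley
begin

lemma residue_cases:
  obtains "delta x = 1" "R x = 0" "N x = 0" | "delta x = 0" "R x = 1" "N x = 0"
    | "delta x = 0" "R x = 0" "N x = 1"
  using delta_R_N[of x] by (auto simp: delta_def R_def N_def of_bool_def split: if_splits)

text \<open>The value is 1 on fourth powers, -1 on the other residues and 0 elsewhere. For odd
  \<open>M\<close> the residues with value -1 are the negatives of fourth powers.\<close>

definition D :: "int \<Rightarrow> int" where
  "D x = of_bool ([x ^ M = 1] (mod p)) - of_bool ([x ^ M = - 1] (mod p))"

lemma periodic_D [intro, simp]: "periodic D"
  using periodic_power unfolding D_def periodic_def by simp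

lemma periodic_D_scaled [intro, simp]: "periodic (\<lambda>x. D (t * x))"
  by auto

lemma D_scale:
  assumes "[t ^ M = e] (mod p)" "e = 1 \<or> e = - 1"
  shows "D (t * x) = e * D x"
proof -
  have "e * e = 1" using assms(2) by auto
  from power_scale_iff[OF assms(1) this] show ?thesis
    using assms(2) by (auto simp: D_def)
qed

lemma square_root_cases:
  assumes "[t ^ (2 * M) = 1] (mod p)"
  obtains e where "[t ^ M = e] (mod p)" "e = 1 \<or> e = - 1"
proof -
  have "p dvd (t ^ M - 1) * (t ^ M + 1)"
    using assms[unfolded mult_2 power_add] by (simp add: cong_iff_dvd_diff algebra_simps)
  then have "p dvd t ^ M - 1 \<or> p dvd t ^ M + 1"
    using prime_p by (simp add: prime_dvd_mult_iff)
  then show ?thesis using that[of 1] that[of "-1"] by (auto simp: cong_iff_dvd_diff)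
qed

lemma D_square: "D x * D x = R x"
proof (cases "[x ^ (2 * M) = 1] (mod p)")
  case True
  then obtain e where e: "[x ^ M = e] (mod p)" "e = 1 \<or> e = - 1"
    by (rule square_root_cases)
  then have "\<not> [x ^ M = - e] (mod p)"
    using one_not_cong_minus_one by (metis cong_sym cong_trans minus_minus)
  then show ?thesis using e True by (auto simp: D_def R_def)
next
  case False
  have "\<not> [x ^ M = e] (mod p)" if "e = 1 \<or> e = - 1" for e
  proof
    assume "[x ^ M = e] (mod p)"
    from cong_mult[OF this this] have "[x ^ (2 * M) = 1] (mod p)"
      using that by (auto simp: mult_2 power_add)
    then show False using False by simp
  qed
  then show ?thesis using False by (simp add: D_def R_def)
qed

lemma D_1 [simp]: "D 1 = 1"
  using one_not_cong_minus_one by (simp add: D_def)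

text \<open>Dilation by the quartic residue \<open>q\<close> fixes \<open>D\<close>. The factor
  \<open>t\<close> makes the lemma cover both \<open>D\<close> and its dilate by
  \<open>g\<close>.\<close>

lemma frobenius_D:
  assumes q: "prime q" "coprime (int q) p" and qM: "[int q ^ M = 1] (mod p)"
  shows "gcong q (emb (\<lambda>x. D (t * x)) ^ q) (emb (\<lambda>x. D (t * x)))"
proof -
  have "D (t * (int q * x)) = D (t * x)" for x
    using D_scale[OF qM, of "t * x"] by (simp add: mult.left_commute)
  then show ?thesis
    using frobenius[OF q, of "\<lambda>x. D (t * x)"] by simp
qed

end

section \<open>Products of D and its dilate, and divisors of their coefficients\<close>

locale paley_odd = paley +
  assumes odd_M: "odd M"
begin

lemma D_minus [simp]: "D (- x) = - D x"
  using D_scale[of "-1" "-1" x] odd_M by simp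

lemma sum_D: "(\<Sum>x\<in>{0..<p}. D x) = 0"
  using sum_scale[OF periodic_D, of "-1"] by (simp add: sum_negf)

abbreviation D' :: "int \<Rightarrow> int" where
  "D' \<equiv> \<lambda>x. D (g * x)"

lemma D_D'_disjoint: "D x * D' x = 0"
proof -
  have "(D x * D' x) * (D x * D' x) = (D x * D x) * (D' x * D' x)"
    by (simp only: mult_ac)
  also have "\<dots> = 0"
    by (simp only: D_square nonresidue_scale[OF g] R_mult_N)
  finally have "(D x * D' x) * (D x * D' x) = 0" .
  then show ?thesis by simp
qed

definition c1 :: int where "c1 = conv D D 1"
definition c2 :: int where "c2 = conv D D g"
definition w :: int where "w = conv D D' 1"

lemma coprime_residue: "[t ^ (2 * M) = 1] (mod p) \<Longrightarrow> coprime t p"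
  using power_unit_coprime[of t "2 * M" 1] M_pos by simp

lemma conv_mult_const: "conv (\<lambda>x. c * \<phi> x) (\<lambda>x. d * \<psi> x) z = c * d * conv \<phi> \<psi> z"
  by (simp add: conv_def sum_distrib_left mult_ac)

text \<open>Dilation by a residue changes both factors by the same sign, which cancels; hence these
  convolutions are class functions although \<open>D\<close> is not.\<close>

lemma conv_residue_scale:
  assumes t: "[t ^ (2 * M) = 1] (mod p)"
  shows "conv (\<lambda>x. D (r * x)) (\<lambda>x. D (s * x)) (t * z) = conv (\<lambda>x. D (r * x)) (\<lambda>x. D (s * x)) z"
proof -
  obtain e where e: "[t ^ M = e] (mod p)" "e = 1 \<or> e = - 1"
    using t by (rule square_root_cases)
  have D: "D (r * (t * x)) = e * D (r * x)" for r x
    using D_scale[OF e, of "r * x"] by (simp add: mult.left_commute)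
  have "conv (\<lambda>x. D (r * x)) (\<lambda>x. D (s * x)) (t * z)
      = conv (\<lambda>x. e * D (r * x)) (\<lambda>x. e * D (s * x)) z"
    by (subst conv_scale[OF periodic_D_scaled periodic_D_scaled coprime_residue[OF t]]) (simp add: D)
  also have "\<dots> = conv (\<lambda>x. D (r * x)) (\<lambda>x. D (s * x)) z"
    unfolding conv_mult_const using e(2) by auto
  finally show ?thesis .
qed

lemma conv_D_0: "conv D D 0 = - 2 * int M"
  by (simp add: conv_def D_square sum_negf sum_R)

lemma conv_D_D: "conv D D x = - 2 * int M * delta x + c1 * R x + c2 * N x"
  using class_function[of "conv D D" x] conv_residue_scale[of _ 1 1] periodic_conv[OF periodic_D]
  by (simp add: conv_D_0 c1_def c2_def)

lemma delta_g [simp]: "delta (g * x) = delta x"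
  using coprime_g by (simp add: delta_def coprime_dvd_mult_right_iff coprime_commute)

lemma conv_D'_D': "conv D' D' x = - 2 * int M * delta x + c2 * R x + c1 * N x"
proof -
  have "conv D' D' x = conv D D (g * x)"
    by (rule conv_scale[OF periodic_D periodic_D coprime_g, symmetric])
  then show ?thesis
    by (simp add: conv_D_D nonresidue_scale[OF g])
qed

text \<open>Compare total sums: \<open>D\<close> is odd and so has sum 0, and therefore so has its
  convolution square.\<close>

lemma c1_plus_c2: "c1 + c2 = 1"
proof -
  have "0 = (\<Sum>x\<in>{0..<p}. conv D D x)"
    by (simp add: sum_conv sum_D)
  also have "\<dots> = - 2 * int M * (\<Sum>x\<in>{0..<p}. delta x * 1)
      + c1 * (\<Sum>x\<in>{0..<p}. R x) + c2 * (\<Sum>x\<in>{0..<p}. N x)"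
    by (simp only: conv_D_D sum.distrib sum_distrib_left mult.right_neutral)
  also have "\<dots> = 2 * int M * (c1 + c2 - 1)"
    by (simp only: sum_delta sum_R sum_N) (simp add: algebra_simps)
  finally show ?thesis using M_pos by simp
qed

text \<open>Since (g g)^M = -1, dilation by \<open>g\<close> turns the pair \<open>D\<close>,
  \<open>D'\<close> into \<open>D'\<close>, \<open>-D\<close>; so the values at 1 and
  \<open>g\<close> are opposite.\<close>

lemma conv_D_D': "conv D D' x = w * (R x - N x)"
proof -
  have 0: "conv D D' 0 = 0"
    by (simp add: conv_def D_D'_disjoint)
  have gg: "[(g * g) ^ M = - 1] (mod p)"
    using g by (simp add: power_mult_distrib mult_2 power_add)
  have "conv D D' (g * 1) = conv D' (\<lambda>x. D (g * (g * x))) 1"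
    by (rule conv_scale[OF periodic_D periodic_D_scaled coprime_g])
  also have "(\<lambda>x. D (g * (g * x))) = (\<lambda>x. - 1 * D x)"
    using D_scale[OF gg] by (simp add: mult.assoc fun_eq_iff)
  also have "conv D' (\<lambda>x. - 1 * D x) 1 = - conv D' D 1"
    using conv_mult_const[of 1 D' "-1" D 1] by simp
  also have "conv D' D 1 = conv D D' 1"
    by (rule conv_commute) auto
  finally have 1: "conv D D' g = - w" by (simp add: w_def)
  show ?thesis
    using class_function[of "conv D D'" x] conv_residue_scale[of _ 1 g]
      periodic_conv[OF periodic_D_scaled] 0 1
    by (simp add: w_def right_diff_distrib mult.commute[of _ "R x"] mult.commute[of _ "N x"])
qed

text \<open>In the integral group ring (D D')^2 = (D D)(D' D'). Comparing coefficients at 0 gives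
  w^2 = M + c1 c2, and c1 + c2 = 1 turns this into the claim.\<close>

lemma p_two_squares: "p = (c1 - c2)\<^sup>2 + (2 * w)\<^sup>2"
proof -
  have "gcong 0 (emb (conv (conv D D') (conv D D'))) (emb (conv D D') * emb (conv D D'))"
    by (rule gcong_sym[OF emb_mult]) auto
  also have "gcong 0 \<dots> ((emb D * emb D') * (emb D * emb D'))"
    by (intro gcong_mult gcong_sym[OF emb_mult]) auto
  also have "(emb D * emb D') * (emb D * emb D') = (emb D * emb D) * (emb D' * emb D')"
    by (simp add: mult_ac)
  also have "gcong 0 \<dots> (emb (conv D D) * emb (conv D' D'))"
    by (intro gcong_mult emb_mult) auto
  also have "gcong 0 \<dots> (emb (conv (conv D D) (conv D' D')))"
    by (rule emb_mult) auto
  finally have "conv (conv D D') (conv D D') 0 = conv (conv D D) (conv D' D') 0"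
    using gcong_embD[of 0 "conv (conv D D') (conv D D')" "conv (conv D D) (conv D' D')" 0]
    by (auto simp: cong_def)
  moreover have "conv (conv D D') (conv D D') 0 = w * w * (4 * int M)"
  proof -
    have "conv (conv D D') (conv D D') 0 = (\<Sum>y\<in>{0..<p}. w * w * (R y + N y))"
      unfolding conv_def[of "conv D D'"]
    proof (intro sum.cong refl)
      fix y
      show "conv D D' y * conv D D' (0 - y) = w * w * (R y + N y)"
        by (cases y rule: residue_cases) (simp_all add: conv_D_D')
    qed
    then show ?thesis by (simp add: sum.distrib sum_R sum_N flip: sum_distrib_left)
  qed
  moreover have "conv (conv D D) (conv D' D') 0 = 4 * int M * int M + c1 * c2 * (4 * int M)"
  proof -
    have "conv (conv D D) (conv D' D') 0
        = (\<Sum>y\<in>{0..<p}. delta y * (4 * int M * int M) + c1 * c2 * (R y + N y))"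
      unfolding conv_def[of "conv D D"]
    proof (intro sum.cong refl)
      fix y
      have dm: "delta (- y) = delta y" by (simp add: delta_def)
      show "conv D D y * conv D' D' (0 - y)
          = delta y * (4 * int M * int M) + c1 * c2 * (R y + N y)"
        by (cases y rule: residue_cases) (simp_all add: conv_D_D conv_D'_D' dm)
    qed
    also have "\<dots> = (\<Sum>y\<in>{0..<p}. delta y * (4 * int M * int M)) + c1 * c2 * (4 * int M)"
      by (simp add: sum.distrib sum_R sum_N flip: sum_distrib_left)
    finally show ?thesis by (simp only: sum_delta)
  qed
  ultimately have "4 * int M * (w * w) = 4 * int M * (int M + c1 * c2)"
    by (simp add: algebra_simps)
  then have ww: "w * w = int M + c1 * c2" using M_pos by simp
  have "(c1 - c2)\<^sup>2 = (c1 + c2) * (c1 + c2) - 4 * (c1 * c2)" "(2 * w)\<^sup>2 = 4 * (w * w)"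
    by (simp_all add: power2_eq_square algebra_simps)
  then show ?thesis
    using ww c1_plus_c2 p_eq by (simp only:) simp
qed

lemma odd_c1_minus_c2: "odd (c1 - c2)"
  using c1_plus_c2 by presburger

text \<open>Modulo \<open>q\<close> one has 2 D D = J - 1 with \<open>J\<close> the sum of all group
  elements, and D J = 0, so 2 D^3 = - D. Iterating up to D^q = D gives a congruence that by Euler's
  criterion says that -2 is a square modulo \<open>q\<close>.\<close>

lemma divisor_of_odd_part:
  assumes q: "prime q" "odd q" "q dvd M" "[int q ^ M = 1] (mod p)"
    and u: "int q dvd c1 - c2"
  shows "[2 ^ ((q - 1) div 2) = (- 1) ^ ((q - 1) div 2)] (mod int q)"
proof -
  define J where "J = emb (\<lambda>_. 1)"
  have "gcong q (emb D * J) (emb (conv D (\<lambda>_. 1)))"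
    unfolding J_def by (rule emb_mult) (simp add: periodic_def)
  also have "emb (conv D (\<lambda>_. 1)) = 0"
    by (simp add: emb_def conv_const sum_D)
  finally have J: "gcong q (emb D * J) 0" .
  \<comment> \<open>From c1 + c2 = 1 and c1 = c2 modulo \<open>q\<close>, both 2 c1 and 2 c2 are
    1.\<close>
  have coeff: "[2 * conv D D x = 1 - delta x] (mod int q)" for x
  proof -
    have "2 * conv D D x - (1 - delta x)
        = int M * (- 4 * delta x) + (c1 - c2) * (R x - N x)"
      using c1_plus_c2 by (cases x rule: residue_cases) (simp_all add: conv_D_D)
    moreover have "int q dvd \<dots>" using q(3) u by (intro dvd_add dvd_mult2) auto
    ultimately show ?thesis by (simp add: cong_iff_dvd_diff)
  qed
  have "gcong q (smult 2 (emb D * emb D)) (smult 2 (emb (conv D D)))"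
    by (intro gcong_smult emb_mult) simp
  also have "smult 2 (emb (conv D D)) = emb (\<lambda>x. 2 * conv D D x)"
    by (simp add: emb_mult_const)
  also have "gcong q \<dots> (emb (\<lambda>x. 1 - delta x))"
    using coeff by (rule gcong_emb)
  also have "\<dots> = J - 1" by (simp add: emb_diff J_def)
  finally have "gcong q (emb D * smult 2 (emb D * emb D)) (emb D * (J - 1))"
    by (rule gcong_mult[OF gcong_refl])
  also have "emb D * (J - 1) = emb D * J - emb D" by (simp add: algebra_simps)
  also have "gcong q \<dots> (0 - emb D)"
    by (rule gcong_diff[OF J gcong_refl])
  finally have cube: "gcong q (smult 2 (emb D * (emb D * emb D))) (- emb D)" by simp
  have pow: "gcong q (smult (2 ^ k) (emb D ^ (2 * k + 1))) (smult ((- 1) ^ k) (emb D))" for k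
  proof (induction k)
    case (Suc k)
    have "smult (2 ^ Suc k) (emb D ^ (2 * Suc k + 1))
        = smult (2 ^ k) (emb D ^ (2 * k + 1)) * smult 2 (emb D * emb D)"
      by (simp add: mult_ac)
    also have "gcong q \<dots> (smult ((- 1) ^ k) (emb D) * smult 2 (emb D * emb D))"
      by (rule gcong_mult[OF Suc.IH gcong_refl])
    also have "\<dots> = smult ((- 1) ^ k) (smult 2 (emb D * (emb D * emb D)))"
      by (simp add: mult_ac)
    also have "gcong q \<dots> (smult ((- 1) ^ k) (- emb D))"
      by (rule gcong_smult[OF cube])
    finally show ?case by simp
  qed simp
  define k where "k = (q - 1) div 2"
  have "q = 2 * k + 1" using q(2) by (auto simp: k_def elim: oddE)
  then have "gcong q (smult (2 ^ k) (emb D ^ q)) (smult ((- 1) ^ k) (emb D))"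
    using pow[of k] by simp
  then have "gcong q (smult (2 ^ k) (emb D)) (smult ((- 1) ^ k) (emb D))"
    using gcong_trans[OF gcong_smult[OF gcong_sym]] frobenius_D[OF q(1) coprime_divisor[OF q(3)] q(4), of 1] by simp
  then have "gcong q (emb (\<lambda>x. 2 ^ k * D x)) (emb (\<lambda>x. (- 1) ^ k * D x))"
    by (simp add: emb_mult_const)
  from gcong_embD[OF this, of 1] show ?thesis
    by (simp add: k_def periodic_def periodic_D[unfolded periodic_def])
qed

text \<open>Modulo \<open>q\<close> the coefficients c1, c2 are 1, 0 in some order, so
  \<open>D\<close> or its dilate is a square root E of R. If q = 4 k + 3, then E^(q + 1) is E E = R
  by Frobenius, but also R^(2 k + 2) = - R because R R = - R.\<close>

lemma divisor_of_even_part: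
  assumes q: "prime q" "odd q" "q dvd M" "[int q ^ M = 1] (mod p)"
    and w: "int q dvd w"
  shows "q mod 4 = 1"
proof (rule ccontr)
  assume "q mod 4 \<noteq> 1"
  then have "q mod 4 = 3" using q(2) by presburger
  then obtain k where k: "q = 4 * k + 3" by (metis mult_div_mod_eq)
  have "(c1 - c2 - 1) * (c1 - c2 + 1) = 4 * int M - 4 * w * w"
    using p_two_squares p_eq by (simp add: power2_eq_square algebra_simps)
  moreover have "int q dvd 4 * int M - 4 * w * w" using q(3) w by auto
  ultimately have "int q dvd c1 - c2 - 1 \<or> int q dvd c1 - c2 + 1"
    using q(1) by (metis prime_dvd_mult_iff prime_nat_int_transfer)
  moreover have "c1 - c2 - 1 = 2 * (c1 - 1)" "c1 - c2 - 1 = 2 * (- c2)"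
    "c1 - c2 + 1 = 2 * c1" "c1 - c2 + 1 = 2 * (1 - c2)"
    using c1_plus_c2 by auto
  moreover have two: "int q dvd 2 * x \<longleftrightarrow> int q dvd x" for x
    using q(2) by (intro coprime_dvd_mult_right_iff) simp
  ultimately have "int q dvd c1 - 1 \<and> int q dvd c2 \<or> int q dvd c1 \<and> int q dvd 1 - c2"
    by (metis dvd_minus_iff)
  \<comment> \<open>The witness is 1 or \<open>g\<close>, according to which of c1, c2 is 1 modulo
    \<open>q\<close>.\<close>
  then obtain r where sq: "\<And>x. [conv (\<lambda>x. D (r * x)) (\<lambda>x. D (r * x)) x = R x] (mod int q)"
  proof (elim disjE conjE)
    assume c: "int q dvd c1 - 1" "int q dvd c2"
    have "conv D D x - R x = int M * (- 2 * delta x) + (c1 - 1) * R x + c2 * N x" for x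
      by (cases x rule: residue_cases) (simp_all add: conv_D_D)
    moreover have "int q dvd int M * (- 2 * delta x) + (c1 - 1) * R x + c2 * N x" for x
      using c q(3) by (intro dvd_add dvd_mult2) auto
    ultimately show ?thesis using that[of 1] by (simp add: cong_iff_dvd_diff)
  next
    assume c: "int q dvd c1" "int q dvd 1 - c2"
    have "conv D' D' x - R x = int M * (- 2 * delta x) - (1 - c2) * R x + c1 * N x" for x
      by (cases x rule: residue_cases) (simp_all add: conv_D'_D')
    moreover have "int q dvd int M * (- 2 * delta x) - (1 - c2) * R x + c1 * N x" for x
      using q(3) by (intro dvd_add[OF dvd_diff[OF dvd_mult2 dvd_mult2[OF c(2)]] dvd_mult2[OF c(1)]]) simp
    ultimately show ?thesis using that[of g] by (simp add: cong_iff_dvd_diff)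
  qed
  define E where "E = emb (\<lambda>x. D (r * x))"
  have E2: "gcong q (E * E) (emb R)"
    unfolding E_def using gcong_trans[OF emb_mult gcong_emb[OF sq]] by simp
  have R_pow: "gcong q (emb R ^ (n + 1)) (smult ((- 1) ^ n) (emb R))" for n
  proof (induction n)
    case (Suc n)
    have "emb R ^ (Suc n + 1) = emb R ^ (n + 1) * emb R" by (simp add: mult_ac)
    also have "gcong q \<dots> (smult ((- 1) ^ n) (emb R) * emb R)"
      by (rule gcong_mult[OF Suc.IH gcong_refl])
    also have "\<dots> = smult ((- 1) ^ n) (emb R * emb R)" by simp
    also have "gcong q \<dots> (smult ((- 1) ^ n) (- emb R))"
      by (rule gcong_smult[OF emb_R_R[OF q(3)]])
    finally show ?case by simp
  qed simp
  have "gcong q (emb R) (E * E)" by (rule gcong_sym[OF E2])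
  also have "gcong q \<dots> (E ^ q * E)"
    unfolding E_def by (intro gcong_mult gcong_refl gcong_sym[OF frobenius_D[OF q(1) coprime_divisor[OF q(3)] q(4)]])
  also have "E ^ q * E = E ^ (2 * (2 * k + 2))"
  proof -
    have "2 * (2 * k + 2) = Suc q" by (simp add: k)
    then show ?thesis by (simp only: power_Suc2)
  qed
  also have "\<dots> = (E * E) ^ (2 * k + 2)"
    by (simp only: power_mult power2_eq_square)
  also have "gcong q \<dots> (emb R ^ (2 * k + 2))"
    by (rule gcong_power[OF E2])
  also have "gcong q \<dots> (smult ((- 1) ^ (2 * k + 1)) (emb R))"
    using R_pow[of "2 * k + 1"] by simp
  also have "smult ((- 1) ^ (2 * k + 1)) (emb R) = emb (\<lambda>x. - 1 * R x)"
    by (simp only: emb_mult_const) simp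
  finally have "[R 1 = - 1 * R 1] (mod int q)"
    by (rule gcong_embD) (auto simp: periodic_def periodic_R[unfolded periodic_def])
  then have "int q dvd 2" by (simp add: cong_iff_dvd_diff)
  then have "int q \<le> 2" by (rule zdvd_imp_le) simp
  then show False using k by simp
qed

end

section \<open>Choice of M and g, and the conclusion\<close>

lemma diff_exact_QR_set_mod_4:
  assumes p: "prime p" and exact: "diff_exact p A (QR_set p)"
  obtains M where "p = 4 * int M + 1"
proof -
  have p1: "p > 1" using p by (simp add: prime_gt_1_int)
  have "[1\<^sup>2 = 1] (mod p)" by simp
  then have "1 \<in> QR_set p" using p1 unfolding QR_set_def QuadRes_def by (auto intro: exI[of _ 1])
  then obtain x where x: "fst x \<in> A" "snd x \<in> A" "(fst x - snd x) mod p = 1"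
    and uniq: "\<And>y. fst y \<in> A \<and> snd y \<in> A \<and> (fst y - snd y) mod p = 1 \<Longrightarrow> y = x"
    using exact unfolding diff_exact_def by blast
  \<comment> \<open>The residue 1 is a difference in \<open>A\<close>; the reversed difference is
    also a residue, so -1 is a residue.\<close>
  have ne: "fst x \<noteq> snd x" using x(3) p1 by auto
  then have "(snd x - fst x) mod p \<in> QR_set p"
    using exact x unfolding diff_exact_def by metis
  moreover have "[fst x - snd x = 1] (mod p)" using x(3) p1 by (simp add: cong_def)
  then have minus: "[snd x - fst x = - 1] (mod p)"
    using cong_minus_minus_iff by fastforce
  ultimately have "QuadRes p (- 1)"
    unfolding QR_set_def QuadRes_def by (auto simp: cong_def)
  \<comment> \<open>For \<open>p = 2\<close> the classes 1 and -1 coincide, and swapping the pair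
    gives a second representation of 1.\<close>
  have "p \<noteq> 2"
  proof
    assume "p = 2"
    then have "(snd x - fst x) mod p = 1" using minus by (simp add: cong_def)
    then have "(snd x, fst x) = x" using uniq[of "(snd x, fst x)"] x by simp
    then show False using ne by (metis fst_conv)
  qed
  then have p2: "p > 2" using p1 by simp
  have "\<not> p dvd 1" using p1 by auto
  then have "Legendre (- 1) p = 1"
    using \<open>QuadRes p (- 1)\<close> by (simp add: Legendre_def cong_0_iff)
  moreover have "[Legendre (- 1) p = (- 1) ^ ((nat p - 1) div 2)] (mod p)"
    using euler_criterion[of "nat p" "- 1"] p p2 by (simp add: prime_nat_iff_prime)
  ultimately have cong: "[1 = (- 1) ^ ((nat p - 1) div 2)] (mod p)" by simp
  have "even ((nat p - 1) div 2)"
  proof (rule ccontr)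
    assume "odd ((nat p - 1) div 2)"
    then have "p dvd 2" using cong by (simp add: cong_iff_dvd_diff)
    then have "p \<le> 2" by (rule zdvd_imp_le) simp
    then show False using p2 by simp
  qed
  moreover have "odd p" using p p2 by (simp add: prime_odd_int)
  then have "odd (nat p)" using p2 by (simp add: even_nat_iff)
  moreover have "m = 4 * ((m - 1) div 4) + 1" if "even ((m - 1) div 2)" "odd m" for m :: nat
    using that by presburger
  ultimately have "nat p = 4 * ((nat p - 1) div 4) + 1" by blast
  then show ?thesis using that[of "(nat p - 1) div 4"] p2 by linarith
qed

text \<open>A primitive root has order 4 M, so its power with exponent 2 M is a square root of 1
  different from 1.\<close>

lemma ex_half_power_minus_one:
  assumes p: "prime p" and p_eq: "p = 4 * int M + 1"
  obtains g where "[g ^ (2 * M) = - 1] (mod p)"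
proof -
  define P where "P = 4 * M + 1"
  have pP: "p = int P" by (simp add: p_eq P_def)
  have P: "prime P" using p by (simp add: pP)
  have M: "M > 0" using P by (cases M) (auto simp: P_def)
  obtain x where x: "residue_primroot P x"
    using prime_primitive_root_exists[of P] P prime_gt_1_nat[OF P] by blast
  then have ord: "ord P x = 4 * M"
    using P by (simp add: residue_primroot_def totient_prime) (simp add: P_def)
  have "[x ^ (4 * M) = 1] (mod P)"
    using ord ord_divides[of x "4 * M" P] by simp
  moreover have "\<not> [x ^ (2 * M) = 1] (mod P)"
    using ord ord_divides[of x "2 * M" P] M by (auto dest: dvd_imp_le)
  ultimately have "[int x ^ (4 * M) = 1] (mod p)" "\<not> [int x ^ (2 * M) = 1] (mod p)"
    unfolding pP by (metis cong_int_iff of_nat_1 of_nat_power)+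
  moreover have "int x ^ (4 * M) - 1 = (int x ^ (2 * M) - 1) * (int x ^ (2 * M) + 1)"
    by (simp add: algebra_simps flip: power_add)
  ultimately have "p dvd int x ^ (2 * M) + 1"
    using p by (simp add: cong_iff_dvd_diff prime_dvd_mult_iff)
  then show ?thesis using that[of "int x"] by (simp add: cong_iff_dvd_diff)
qed

theorem theorem5:
  fixes p :: int and A :: "int set"
  assumes "prime p"
    and "A \<subseteq> {0..<p}"
    and "diff_exact p A (QR_set p)"
  shows "p = 2 * int (card A) * (int (card A) - 1) + 1
    \<and> (\<forall>q::nat. prime q \<and> q dvd card A \<longrightarrow> q mod 8 \<noteq> 7)
    \<and> (\<forall>q::nat. prime q \<and> q dvd card A - 1 \<longrightarrow> q mod 8 \<noteq> 7)
    \<and> (let odd_one = (if odd (card A) then card A else card A - 1);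
           even_one = (if odd (card A) then card A - 1 else card A)
       in (\<forall>q::nat. prime q \<and> q dvd odd_one \<longrightarrow> q mod 8 \<noteq> 5)
        \<and> (\<forall>q::nat. prime q \<and> q dvd even_one \<longrightarrow> q mod 8 \<noteq> 3))"
proof -
  obtain M where M: "p = 4 * int M + 1"
    using diff_exact_QR_set_mod_4[OF assms(1,3)] .
  obtain g where g: "[g ^ (2 * M) = - 1] (mod p)"
    using ex_half_power_minus_one[OF assms(1) M] .
  interpret paley_difference p M g A
    by unfold_locales (use assms M g in auto)
  interpret paley_odd p M g
    by unfold_locales (rule odd_M)
  define s t where "s = (if odd (card A) then card A else card A - 1)"
    and "t = (if odd (card A) then card A - 1 else card A)"
  have "card A > 0"
    using card_product M_pos by (cases "card A") auto
  then have par: "odd s" "even t"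
    by (auto simp: s_def t_def)
  have "p = int s ^ 2 + int t ^ 2"
    using sum_two_squares_card by (simp add: s_def t_def)
  \<comment> \<open>Both representations of \<open>p\<close> split into an odd and an even square,
    so uniqueness matches \<open>s\<close> with \<open>c1 - c2\<close> and \<open>t\<close> with
    \<open>2 * w\<close> up to sign.\<close>
  then have sq: "int s ^ 2 = (c1 - c2)\<^sup>2" "int t ^ 2 = (2 * w)\<^sup>2"
    using odd_even_two_squares_unique[OF assms(1) _ p_two_squares, of "int s" "int t"]
      par odd_c1_minus_c2 by auto
  have odd_part: "q mod 8 \<noteq> 5 \<and> q mod 8 \<noteq> 7" if q: "prime q" "q dvd s" for q
  proof -
    have "odd q" using q(2) par(1) dvd_trans by blast
    have "q dvd card A \<or> q dvd card A - 1" using q(2) by (auto simp: s_def split: if_splits)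
    note quartic = odd_prime_divisor_quartic[OF q(1) \<open>odd q\<close> this]
    have "int q dvd (c1 - c2)\<^sup>2"
      unfolding sq(1)[symmetric] using q(2) by (simp add: power2_eq_square)
    then have "int q dvd c1 - c2"
      using q(1) by (metis prime_dvd_power prime_nat_int_transfer)
    then have "[2 ^ ((q - 1) div 2) = (- 1) ^ ((q - 1) div 2)] (mod int q)"
      using divisor_of_odd_part[OF q(1) \<open>odd q\<close> quartic]
      by blast
    \<comment> \<open>As 1 and -1 differ modulo the odd prime \<open>q\<close>, this forces
      \<open>(q - 1) div 4\<close> to be even, which fails for the classes 5 and 7 modulo 8.\<close>
    then have cong: "[(- 1) ^ ((q - 1) div 2 - (q - 1) div 4) = (- 1) ^ ((q - 1) div 2)] (mod int q)"
      using two_power_half_cong[OF q(1) \<open>odd q\<close>] cong_sym cong_trans by blast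
    have neq: "\<not> [1 = - 1] (mod int q)" "\<not> [- 1 = 1] (mod int q)"
    proof -
      have "\<not> int q dvd 2"
        using \<open>odd q\<close> q(1) by (metis int_dvd_int_iff of_nat_numeral primes_dvd_imp_eq two_is_prime_nat dvd_refl)
      then show "\<not> [1 = - 1] (mod int q)" "\<not> [- 1 = 1] (mod int q)"
        by (simp_all add: cong_iff_dvd_diff)
    qed
    have "q mod 8 \<noteq> 5"
    proof
      assume "q mod 8 = 5"
      then obtain k where "q = 8 * k + 5" by (metis mult_div_mod_eq)
      then have "(q - 1) div 2 = 2 * (2 * k + 1)" "(q - 1) div 4 = 2 * k + 1" by simp_all
      then show False using cong neq by simp
    qed
    moreover have "q mod 8 \<noteq> 7"
    proof
      assume "q mod 8 = 7"
      then obtain k where "q = 8 * k + 7" by (metis mult_div_mod_eq)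
      then have "(q - 1) div 2 = 2 * (2 * k + 1) + 1" "(q - 1) div 4 = 2 * k + 1" by simp_all
      then show False using cong neq by simp
    qed
    ultimately show ?thesis ..
  qed
  have even_part: "q mod 8 \<noteq> 3 \<and> q mod 8 \<noteq> 7" if q: "prime q" "q dvd t" for q
  \<comment> \<open>Unlike \<open>s\<close>, the even number \<open>t\<close> can have the prime
    divisor 2, which lies in neither excluded class.\<close>
  proof (cases "odd q")
    case True
    have "q dvd card A \<or> q dvd card A - 1" using q(2) by (auto simp: t_def split: if_splits)
    note quartic = odd_prime_divisor_quartic[OF q(1) True this]
    have "int q dvd (2 * w)\<^sup>2"
      unfolding sq(2)[symmetric] using q(2) by (simp add: power2_eq_square)
    then have "int q dvd 2 * w"
      using q(1) by (metis prime_dvd_power prime_nat_int_transfer)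
    then have "int q dvd w"
      using True by (subst (asm) coprime_dvd_mult_right_iff) auto
    then have "q mod 4 = 1"
      using divisor_of_even_part[OF q(1) True quartic] by blast
    then show ?thesis by presburger
  next
    case False
    then show ?thesis by presburger
  qed
  have "p = 2 * int (card A) * (int (card A) - 1) + 1"
    using card_A_eq M by simp
  moreover have "q mod 8 \<noteq> 7" if "prime q" "q dvd card A \<or> q dvd card A - 1" for q
  proof -
    have "q dvd s \<or> q dvd t" using that(2) by (auto simp: s_def t_def)
    then show ?thesis using that(1) odd_part even_part by blast
  qed
  ultimately show ?thesis
    using odd_part even_part unfolding Let_def s_def[symmetric] t_def[symmetric] by blast
qed

end
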